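(* For every even integer $L\ge 6$, there is an asymptotic cone of $X_L$ that contains an isometrically embedded unit length circle.
   Context: For an even integer $L\ge 6$, $$G_L:=\langle a,x,y,s,t\mid sas^{-1}=x,\ tat^{-1}=y,\ a^L=xy,\ [a,x]=[x,y]=[y,a]=1\rangle .$$ The snowflake graph $X_L$ is the Cayley graph of $G_L$ with respect to $\{a,x,y,s,t\}$, metrized as a path metric graph in which $a$-, $s$- and $t$-edges have length $1$ and $x$- and $y$-edges have length $L$. The induced metric on vertices is the word metric of $G_L$ with respect to $\{a,s,t\}$. Given a non-principal ultrafilter $\omega$ on $\mathbb{N}$, a sequence $\mathbf{s}=(s_n)$ of positive reals tending to infinity, and a sequence $\mathbf{o}=(o_n)$ of points of a metric space $(X,d)$, define $d_{\omega,\mathbf{s}}(\mathbf{x},\mathbf{y}):=\lim_\omega d(x_n,y_n)/s_n$ on sequences of points of $X$. The asymptotic cone $\mathrm{Cone}_\omega(X,\mathbf{o},\mathbf{s})$ is the quotient of the set of sequences at finite $d_{\omega,\mathbf{s}}$-distance from $\mathbf{o}$ obtained by identifying sequences at $d_{\omega,\mathbf{s}}$-distance $0$. An asymptotic cone of $X$ is any such space. The unit length circle carries its length metric. *)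

theory Defs
  imports "HOL-Analysis.Analysis" "HOL-Algebra.Group" "Graph_Theory.Digraph"
begin

section \<open>Group presentations\<close>

text \<open>
  A letter is a generator with a sign: \<open>(g, True)\<close> stands for \<open>g\<close> and \<open>(g, False)\<close> for its inverse.
\<close>

type_synonym 'g word = "('g \<times> bool) list"

definition word_inv :: "'g word \<Rightarrow> 'g word" where
  "word_inv w = rev (map (\<lambda>(g, b). (g, \<not> b)) w)"

definition word_comm :: "'g word \<Rightarrow> 'g word \<Rightarrow> 'g word" where
  "word_comm u v = u @ v @ word_inv u @ word_inv v"

text \<open>
  The group with the elements of the type \<open>'g\<close> as generators and with a relation \<open>u = v\<close>
  for each pair \<open>(u, v)\<close> in \<open>R\<close>: words modulo the least congruence that contains free
  cancellation and \<open>R\<close>.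
\<close>

inductive pres_eq :: "('g word \<times> 'g word) set \<Rightarrow> 'g word \<Rightarrow> 'g word \<Rightarrow> bool"
  for R :: "('g word \<times> 'g word) set" where
  refl: "pres_eq R u u"
| sym: "pres_eq R u v \<Longrightarrow> pres_eq R v u"
| trans: "pres_eq R u v \<Longrightarrow> pres_eq R v w \<Longrightarrow> pres_eq R u w"
| append: "pres_eq R u u' \<Longrightarrow> pres_eq R v v' \<Longrightarrow> pres_eq R (u @ v) (u' @ v')"
| cancel: "pres_eq R [(g, b), (g, \<not> b)] []"
| relation: "(u, v) \<in> R \<Longrightarrow> pres_eq R u v"

definition pres_rel :: "('g word \<times> 'g word) set \<Rightarrow> ('g word \<times> 'g word) set" where
  "pres_rel R = {(u, v). pres_eq R u v}"

definition pres_class :: "('g word \<times> 'g word) set \<Rightarrow> 'g word \<Rightarrow> 'g word set" where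
  "pres_class R w = pres_rel R `` {w}"

definition presented_group :: "('g word \<times> 'g word) set \<Rightarrow> 'g word set monoid" where
  "presented_group R =
    \<lparr>carrier = UNIV // pres_rel R,
     mult = (\<lambda>A B. \<Union>u\<in>A. \<Union>v\<in>B. pres_class R (u @ v)),
     one = pres_class R []\<rparr>"

lemma equiv_pres_rel: "equiv UNIV (pres_rel R)"
  by (rule equivI)
     (auto simp: pres_rel_def refl_on_def sym_def trans_def intro: pres_eq.intros)

lemma pres_class_eq_iff: "pres_class R u = pres_class R v \<longleftrightarrow> pres_eq R u v"
  using eq_equiv_class_iff[OF equiv_pres_rel, of u v R]
  by (simp add: pres_class_def pres_rel_def)

lemma mem_pres_class: "v \<in> pres_class R u \<longleftrightarrow> pres_eq R u v"
  by (simp add: pres_class_def pres_rel_def)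

lemma carrier_presented_group: "carrier (presented_group R) = range (pres_class R)"
  by (auto simp: presented_group_def quotient_def pres_class_def)

lemma one_presented_group: "\<one>\<^bsub>presented_group R\<^esub> = pres_class R []"
  by (simp add: presented_group_def)

lemma mult_presented_group:
  "pres_class R u \<otimes>\<^bsub>presented_group R\<^esub> pres_class R v = pres_class R (u @ v)"
proof -
  have *: "pres_class R (u' @ v') = pres_class R (u @ v)"
    if "u' \<in> pres_class R u" "v' \<in> pres_class R v" for u' v'
    using that by (simp add: mem_pres_class pres_class_eq_iff pres_eq.append pres_eq.sym)
  have "u \<in> pres_class R u" "v \<in> pres_class R v"
    by (simp_all add: mem_pres_class pres_eq.refl)
  then have "(\<Union>u'\<in>pres_class R u. \<Union>v'\<in>pres_class R v. pres_class R (u' @ v')) = pres_class R (u @ v)"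
    using * by blast
  then show ?thesis
    by (simp add: presented_group_def)
qed

lemma word_inv_left: "pres_eq R (word_inv w @ w) []"
proof (induction w)
  case Nil
  then show ?case by (simp add: word_inv_def pres_eq.refl)
next
  case (Cons x w)
  obtain g b where x: "x = (g, b)" by (cases x)
  have "pres_eq R ([(g, \<not> b), (g, b)] @ w) ([] @ w)"
    using pres_eq.cancel[of R g "\<not> b"] by (intro pres_eq.append) (simp_all add: pres_eq.refl)
  then have "pres_eq R (word_inv w @ [(g, \<not> b), (g, b)] @ w) (word_inv w @ w)"
    using pres_eq.append[OF pres_eq.refl] by fastforce
  then show ?case
    using Cons pres_eq.trans by (fastforce simp: x word_inv_def)
qed

lemma group_presented_group: "group (presented_group R)"
proof (rule groupI)
  fix x assume "x \<in> carrier (presented_group R)"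
  then obtain w where x: "x = pres_class R w" by (auto simp: carrier_presented_group)
  have "pres_class R (word_inv w) \<otimes>\<^bsub>presented_group R\<^esub> x = \<one>\<^bsub>presented_group R\<^esub>"
    by (simp add: x mult_presented_group one_presented_group pres_class_eq_iff word_inv_left)
  then show "\<exists>y\<in>carrier (presented_group R). y \<otimes>\<^bsub>presented_group R\<^esub> x = \<one>\<^bsub>presented_group R\<^esub>"
    by (auto simp: carrier_presented_group)
qed (auto simp: carrier_presented_group mult_presented_group one_presented_group)

definition word_eval :: "('a, 'm) monoid_scheme \<Rightarrow> ('g \<Rightarrow> 'a) \<Rightarrow> 'g word \<Rightarrow> 'a" where
  "word_eval H f w = foldr (\<lambda>(g, b) h. (if b then f g else inv\<^bsub>H\<^esub> f g) \<otimes>\<^bsub>H\<^esub> h) w \<one>\<^bsub>H\<^esub>"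

lemma presented_group_universal:
  assumes "group H" and f: "\<And>g. f g \<in> carrier H"
    and R: "\<And>u v. (u, v) \<in> R \<Longrightarrow> word_eval H f u = word_eval H f v"
  shows "\<exists>h\<in>hom (presented_group R) H. \<forall>w. h (pres_class R w) = word_eval H f w"
proof -
  interpret H: group H by fact
  have cl: "word_eval H f w \<in> carrier H" for w
    by (induction w) (auto simp: word_eval_def f)
  have app: "word_eval H f (u @ v) = word_eval H f u \<otimes>\<^bsub>H\<^esub> word_eval H f v" for u v
  proof (induction u)
    case Nil
    then show ?case using cl[of v] by (simp add: word_eval_def)
  next
    case (Cons x u)
    then show ?case using cl[of u] cl[of v] f
      by (cases x) (auto simp: word_eval_def H.m_assoc)
  qed
  have eq: "word_eval H f u = word_eval H f v" if "pres_eq R u v" for u v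
    using that
  proof induction
    case (cancel g b)
    then show ?case using f[of g] by (cases b) (auto simp: word_eval_def)
  qed (auto simp: app R)
  define h where "h A = word_eval H f (SOME w. w \<in> A)" for A
  have h: "h (pres_class R w) = word_eval H f w" for w
  proof -
    have "w \<in> pres_class R w" by (simp add: mem_pres_class pres_eq.refl)
    then have "(SOME v. v \<in> pres_class R w) \<in> pres_class R w" by (rule someI)
    then show ?thesis by (simp add: h_def mem_pres_class eq)
  qed
  have "h \<in> hom (presented_group R) H"
    by (auto simp: hom_def carrier_presented_group mult_presented_group h cl app)
  then show ?thesis using h by blast
qed


section \<open>Metric graphs\<close>

text \<open>
  The arc \<open>e\<close> of a digraph is realised as a segment of length \<open>l e\<close> whose ends are glued to
  the end vertices of \<open>e\<close>; the orientation of \<open>e\<close> only serves to parametrise the segment.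
\<close>

datatype ('v, 'e) graph_point = Vertex 'v | Inner 'e real

definition graph_points ::
    "('v, 'e) pre_digraph \<Rightarrow> ('e \<Rightarrow> real) \<Rightarrow> ('v, 'e) graph_point set" where
  "graph_points G l = Vertex ` verts G \<union> {Inner e t | e t. e \<in> arcs G \<and> 0 < t \<and> t < l e}"

definition edge_point ::
    "('v, 'e) pre_digraph \<Rightarrow> ('e \<Rightarrow> real) \<Rightarrow> 'e \<Rightarrow> real \<Rightarrow> ('v, 'e) graph_point" where
  "edge_point G l e t =
    (if t = 0 then Vertex (tail G e) else if t = l e then Vertex (head G e) else Inner e t)"

text \<open>
  \<open>pl_path G l p q r\<close>: some piecewise linear path from \<open>p\<close> to \<open>q\<close> has length \<open>r\<close>.
\<close>

inductive pl_path ::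
    "('v, 'e) pre_digraph \<Rightarrow> ('e \<Rightarrow> real) \<Rightarrow>
      ('v, 'e) graph_point \<Rightarrow> ('v, 'e) graph_point \<Rightarrow> real \<Rightarrow> bool"
  for G :: "('v, 'e) pre_digraph" and l :: "'e \<Rightarrow> real" where
  const: "p \<in> graph_points G l \<Longrightarrow> pl_path G l p p 0"
| segment: "e \<in> arcs G \<Longrightarrow> t \<in> {0..l e} \<Longrightarrow> t' \<in> {0..l e} \<Longrightarrow>
    pl_path G l (edge_point G l e t') q r \<Longrightarrow>
    pl_path G l (edge_point G l e t) q (\<bar>t - t'\<bar> + r)"

definition graph_dist ::
    "('v, 'e) pre_digraph \<Rightarrow> ('e \<Rightarrow> real) \<Rightarrow>
      ('v, 'e) graph_point \<Rightarrow> ('v, 'e) graph_point \<Rightarrow> real" where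
  "graph_dist G l p q =
    (if p \<in> graph_points G l \<and> q \<in> graph_points G l then Inf {r. pl_path G l p q r} else 0)"

text \<open>
  The value of \<open>metric\<close> is meaningful for connected graphs whose edge lengths have a positive
  lower bound, see \<open>Metric_space_graph\<close> below.
\<close>

definition metric_graph ::
    "('v, 'e) pre_digraph \<Rightarrow> ('e \<Rightarrow> real) \<Rightarrow> ('v, 'e) graph_point metric" where
  "metric_graph G l = metric (graph_points G l, graph_dist G l)"

lemma pl_path_nonneg: "pl_path G l p q r \<Longrightarrow> 0 \<le> r"
  by (induction rule: pl_path.induct) auto

lemma pl_path_append:
  "pl_path G l p q r \<Longrightarrow> pl_path G l q p' r' \<Longrightarrow> pl_path G l p p' (r + r')"
proof (induction rule: pl_path.induct)
  case (segment e t t' q r)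
  then show ?case using pl_path.segment[of e G t l t' p' "r + r'"] by (simp add: add.assoc)
qed simp

lemma edge_point_in_graph_points:
  "wf_digraph G \<Longrightarrow> e \<in> arcs G \<Longrightarrow> t \<in> {0..l e} \<Longrightarrow> edge_point G l e t \<in> graph_points G l"
  by (auto simp: edge_point_def graph_points_def wf_digraph_def)

lemma pl_path_segment:
  assumes "wf_digraph G" "e \<in> arcs G" "t \<in> {0..l e}" "t' \<in> {0..l e}"
  shows "pl_path G l (edge_point G l e t) (edge_point G l e t') \<bar>t - t'\<bar>"
  using pl_path.segment[where r = 0, OF assms(2), of t l t' "edge_point G l e t'"]
    pl_path.const[OF edge_point_in_graph_points[OF assms(1,2), of t' l]] assms(3,4) by simp

lemma pl_path_rev:
  assumes "wf_digraph G" and "pl_path G l p q r"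
  shows "pl_path G l q p r"
  using assms(2)
proof (induction rule: pl_path.induct)
  case (segment e t t' q r)
  have "pl_path G l (edge_point G l e t') (edge_point G l e t) \<bar>t' - t\<bar>"
    using segment assms(1) by (intro pl_path_segment) auto
  from pl_path_append[OF segment.IH this] show ?case
    by (simp add: add.commute abs_minus_commute)
qed (auto intro: pl_path.const)

lemma pl_path_Lipschitz:
  assumes "pl_path G l p q r"
    and "\<And>e t t'. e \<in> arcs G \<Longrightarrow> t \<in> {0..l e} \<Longrightarrow> t' \<in> {0..l e} \<Longrightarrow>
      f (edge_point G l e t') \<le> f (edge_point G l e t) + \<bar>t - t'\<bar>"
  shows "f q \<le> f p + (r::real)"
  using assms(1)
proof (induction rule: pl_path.induct)
  case (segment e t t' q r)
  then show ?case using assms(2)[of e t t'] by auto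
qed auto

lemma pl_path_separated:
  assumes wf: "wf_digraph G" and c: "0 < c" "\<And>e. e \<in> arcs G \<Longrightarrow> c \<le> l e"
    and p: "p \<in> graph_points G l" and q: "q \<in> graph_points G l" and "p \<noteq> q"
  shows "\<exists>\<epsilon>>0. \<forall>r. pl_path G l p q r \<longrightarrow> \<epsilon> \<le> r"
proof -
  have "\<exists>f. f p = 0 \<and> 0 < f q \<and> (\<forall>e\<in>arcs G. \<forall>t\<in>{0..l e}. \<forall>t'\<in>{0..l e}.
      f (edge_point G l e t') \<le> f (edge_point G l e t) + \<bar>t - t'\<bar>)"
  proof (cases p)
    case (Vertex v)
    define A where "A w = (if w = v then 0 else c)" for w
    define f where "f x = (case x of Vertex w \<Rightarrow> A w
      | Inner e t \<Rightarrow> min c (min (t + A (tail G e)) (l e - t + A (head G e))))" for x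
    have A: "0 \<le> A w" "A w \<le> c" for w using c(1) by (auto simp: A_def)
    have f: "f (edge_point G l e t) = min c (min (t + A (tail G e)) (l e - t + A (head G e)))"
      if "e \<in> arcs G" "t \<in> {0..l e}" for e t
      using that c(1) c(2)[of e] A[of "tail G e"] A[of "head G e"]
      by (auto simp: edge_point_def f_def min_def)
    have "f p = 0" by (simp add: Vertex f_def A_def)
    moreover have "0 < f q"
    proof (cases q)
      case (Vertex w)
      then show ?thesis using \<open>p \<noteq> q\<close> \<open>p = Vertex v\<close> c(1) by (simp add: f_def A_def)
    next
      case (Inner e t)
      then have "0 < t" "t < l e" using q by (auto simp: graph_points_def)
      then show ?thesis
        using c(1) A(1)[of "tail G e"] A(1)[of "head G e"] by (simp add: Inner f_def)
    qed
    moreover have "f (edge_point G l e t') \<le> f (edge_point G l e t) + \<bar>t - t'\<bar>"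
      if "e \<in> arcs G" "t \<in> {0..l e}" "t' \<in> {0..l e}" for e t t'
      unfolding f[OF that(1,2)] f[OF that(1,3)] by linarith
    ultimately show ?thesis by blast
  next
    case (Inner e0 t0)
    define d where "d = min t0 (l e0 - t0)"
    have t0: "0 < t0" "t0 < l e0" using p by (auto simp: Inner graph_points_def)
    then have d: "0 < d" by (simp add: d_def)
    define f where "f x = (case x of Vertex w \<Rightarrow> d
      | Inner e t \<Rightarrow> if e = e0 then min d \<bar>t - t0\<bar> else d)"
      for x :: "('a, 'b) graph_point"
    have f: "f (edge_point G l e t) = (if e = e0 then min d \<bar>t - t0\<bar> else d)"
      if "e \<in> arcs G" "t \<in> {0..l e}" for e t
      using that t0 by (auto simp: edge_point_def f_def d_def min_def)
    have "f p = 0" using d by (simp add: Inner f_def)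
    moreover have "0 < f q"
      using \<open>p \<noteq> q\<close> d by (auto simp: f_def Inner split: graph_point.split)
    moreover have "f (edge_point G l e t') \<le> f (edge_point G l e t) + \<bar>t - t'\<bar>"
      if "e \<in> arcs G" "t \<in> {0..l e}" "t' \<in> {0..l e}" for e t t'
      unfolding f[OF that(1,2)] f[OF that(1,3)] using d by auto
    ultimately show ?thesis by blast
  qed
  then obtain f where f: "f p = 0" "0 < f q" "\<And>e t t'. e \<in> arcs G \<Longrightarrow> t \<in> {0..l e} \<Longrightarrow>
      t' \<in> {0..l e} \<Longrightarrow> f (edge_point G l e t') \<le> f (edge_point G l e t) + \<bar>t - t'\<bar>"
    by blast
  have "f q \<le> r" if "pl_path G l p q r" for r
    using pl_path_Lipschitz[OF that, of f] f(1,3) by auto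
  then show ?thesis using f(2) by blast
qed

lemma Metric_space_graph:
  assumes wf: "wf_digraph G" and c: "0 < c" "\<And>e. e \<in> arcs G \<Longrightarrow> c \<le> l e"
    and conn: "\<And>u v. u \<in> verts G \<Longrightarrow> v \<in> verts G \<Longrightarrow> \<exists>r. pl_path G l (Vertex u) (Vertex v) r"
  shows "Metric_space (graph_points G l) (graph_dist G l)"
proof
  let ?P = "graph_points G l"
  let ?S = "\<lambda>p q. {r. pl_path G l p q r}"
  have to_vertex: "\<exists>u\<in>verts G. \<exists>r. pl_path G l p (Vertex u) r" if "p \<in> ?P" for p
  proof (cases p)
    case (Vertex v)
    then have "v \<in> verts G" "pl_path G l p (Vertex v) 0"
      using that pl_path.const[OF that] by (auto simp: graph_points_def)
    then show ?thesis by blast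
  next
    case (Inner e t)
    then have e: "e \<in> arcs G" "0 < t" "t < l e" using that by (auto simp: graph_points_def)
    then have "pl_path G l p (Vertex (tail G e)) \<bar>t - 0\<bar>"
      using pl_path_segment[OF wf e(1), of t l 0] by (simp add: edge_point_def Inner)
    then show ?thesis using wf e(1) by (meson wf_digraph.tail_in_verts)
  qed
  have ne: "?S p q \<noteq> {}" if pq: "p \<in> ?P" "q \<in> ?P" for p q
  proof -
    obtain u r where u: "u \<in> verts G" "pl_path G l p (Vertex u) r" using to_vertex pq by blast
    obtain v r' where v: "v \<in> verts G" "pl_path G l q (Vertex v) r'" using to_vertex pq by blast
    obtain r'' where "pl_path G l (Vertex u) (Vertex v) r''" using conn u v by blast
    then show ?thesis using u v pl_path_append pl_path_rev[OF wf] by blast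
  qed
  have bdd: "bdd_below (?S p q)" for p q
    by (rule bdd_belowI[of _ 0]) (simp add: pl_path_nonneg)
  have sym: "?S p q = ?S q p" for p q using pl_path_rev[OF wf] by blast
  show nonneg: "0 \<le> graph_dist G l p q" for p q
    using ne[of p q] by (auto simp: graph_dist_def pl_path_nonneg intro!: cInf_greatest)
  show "graph_dist G l p q = graph_dist G l q p" for p q
    by (auto simp: graph_dist_def sym[of p])
  show "graph_dist G l p q = 0 \<longleftrightarrow> p = q" if pq: "p \<in> ?P" "q \<in> ?P" for p q
  proof
    assume 0: "graph_dist G l p q = 0"
    show "p = q"
    proof (rule ccontr)
      assume "p \<noteq> q"
      then obtain \<epsilon> where "\<epsilon> > 0" "\<forall>r. pl_path G l p q r \<longrightarrow> \<epsilon> \<le> r"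
        using pl_path_separated[where c=c and l=l] wf c pq by metis
      then have "\<epsilon> \<le> Inf (?S p q)" using ne[OF pq] by (intro cInf_greatest) auto
      then show False using 0 pq \<open>\<epsilon> > 0\<close> by (simp add: graph_dist_def)
    qed
  next
    assume "p = q"
    then have "0 \<in> ?S p q" using pq by (simp add: pl_path.const)
    then have "Inf (?S p q) \<le> 0" using bdd by (rule cInf_lower)
    then show "graph_dist G l p q = 0"
      using nonneg[of p q] pq by (simp add: graph_dist_def)
  qed
  show "graph_dist G l p p' \<le> graph_dist G l p q + graph_dist G l q p'"
    if "p \<in> ?P" "q \<in> ?P" "p' \<in> ?P" for p q p'
  proof -
    have "Inf (?S p p') - r \<le> Inf (?S q p')" if r: "r \<in> ?S p q" for r
    proof (rule cInf_greatest)
      show "?S q p' \<noteq> {}" using ne \<open>q \<in> ?P\<close> \<open>p' \<in> ?P\<close> by blast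
      fix r' assume "r' \<in> ?S q p'"
      then have "Inf (?S p p') \<le> r + r'"
        using r pl_path_append by (intro cInf_lower bdd) blast
      then show "Inf (?S p p') - r \<le> r'" by simp
    qed
    then have "Inf (?S p p') - Inf (?S q p') \<le> Inf (?S p q)"
      using ne[of p q] that by (intro cInf_greatest) (auto simp: algebra_simps)
    then show ?thesis using that by (simp add: graph_dist_def)
  qed
qed

text \<open>
  Cayley graph with respect to the family \<open>\<gamma>\<close> of generators: the arc \<open>(g, c)\<close> joins \<open>g\<close> to
  \<open>g \<gamma>(c)\<close>. Arcs carry their label \<open>c\<close>, so that lengths can be assigned by label.
\<close>

definition cayley_graph ::
    "('a, 'm) monoid_scheme \<Rightarrow> ('c \<Rightarrow> 'a) \<Rightarrow> ('a, 'a \<times> 'c) pre_digraph" where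
  "cayley_graph G \<gamma> =
    \<lparr>verts = carrier G, arcs = carrier G \<times> UNIV,
     tail = (\<lambda>(g, c). g), head = (\<lambda>(g, c). g \<otimes>\<^bsub>G\<^esub> \<gamma> c)\<rparr>"


section \<open>The snowflake graph\<close>

datatype snowflake_gen = Gen_a | Gen_x | Gen_y | Gen_s | Gen_t

definition snowflake_relations :: "nat \<Rightarrow> (snowflake_gen word \<times> snowflake_gen word) set" where
  "snowflake_relations L =
    (let a = [(Gen_a, True)]; x = [(Gen_x, True)]; y = [(Gen_y, True)];
         s = [(Gen_s, True)]; t = [(Gen_t, True)]
     in {(s @ a @ word_inv s, x), (t @ a @ word_inv t, y), (concat (replicate L a), x @ y),
         (word_comm a x, []), (word_comm x y, []), (word_comm y a, [])})"

definition snowflake_group :: "nat \<Rightarrow> snowflake_gen word set monoid" where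
  "snowflake_group L = presented_group (snowflake_relations L)"

definition snowflake_elem :: "nat \<Rightarrow> snowflake_gen \<Rightarrow> snowflake_gen word set" where
  "snowflake_elem L c = pres_class (snowflake_relations L) [(c, True)]"

definition snowflake_length ::
    "nat \<Rightarrow> snowflake_gen word set \<times> snowflake_gen \<Rightarrow> real" where
  "snowflake_length L e = (if snd e \<in> {Gen_x, Gen_y} then real L else 1)"

type_synonym snowflake_point =
  "(snowflake_gen word set, snowflake_gen word set \<times> snowflake_gen) graph_point"

definition snowflake_graph :: "nat \<Rightarrow> snowflake_point metric" where
  "snowflake_graph L =
    metric_graph (cayley_graph (snowflake_group L) (snowflake_elem L)) (snowflake_length L)"

lemma Metric_space_snowflake:
  assumes "1 \<le> L"
  defines "G \<equiv> cayley_graph (snowflake_group L) (snowflake_elem L)"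
  shows "Metric_space (graph_points G (snowflake_length L)) (graph_dist G (snowflake_length L))"
proof -
  let ?l = "snowflake_length L" and ?R = "snowflake_relations L"
  let ?C = "pres_class ?R"
  interpret group "snowflake_group L" by (simp add: snowflake_group_def group_presented_group)
  have el: "snowflake_elem L c \<in> carrier (snowflake_group L)" for c
    by (simp add: snowflake_group_def snowflake_elem_def carrier_presented_group)
  have wf: "wf_digraph G"
    by unfold_locales (auto simp: G_def cayley_graph_def el)
  have len: "1 \<le> ?l e" for e using assms by (simp add: snowflake_length_def)
  have edge: "pl_path G ?l (Vertex (?C u)) (Vertex (?C (u @ [(c, True)]))) (?l (?C u, c))" for u c
    using pl_path_segment[OF wf, of "(?C u, c)" 0 ?l "?l (?C u, c)"] len[of "(?C u, c)"]
    by (auto simp: G_def cayley_graph_def edge_point_def snowflake_group_def snowflake_elem_def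
        carrier_presented_group mult_presented_group)
  have letter: "\<exists>r. pl_path G ?l (Vertex (?C u)) (Vertex (?C (u @ [(c, b)]))) r" for u c b
  proof (cases b)
    case True
    then show ?thesis using edge[of u c] by auto
  next
    case False
    have "pres_eq ?R (u @ [(c, False), (c, True)]) (u @ [])"
      using pres_eq.cancel[of ?R c False] by (intro pres_eq.append pres_eq.refl) simp
    then have "?C ((u @ [(c, False)]) @ [(c, True)]) = ?C u"
      by (simp add: pres_class_eq_iff)
    then show ?thesis using edge[of "u @ [(c, False)]" c] pl_path_rev[OF wf] False by metis
  qed
  have walk: "\<exists>r. pl_path G ?l (Vertex (?C u)) (Vertex (?C (u @ w))) r" for u w
  proof (induction w rule: rev_induct)
    case Nil
    have "Vertex (?C u) \<in> graph_points G ?l"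
      by (simp add: graph_points_def G_def cayley_graph_def snowflake_group_def
          carrier_presented_group)
    then show ?case using pl_path.const by fastforce
  next
    case (snoc x w)
    then show ?case using letter[of "u @ w" "fst x" "snd x"] pl_path_append by fastforce
  qed
  show ?thesis
  proof (rule Metric_space_graph[OF wf zero_less_one len])
    fix p q assume "p \<in> verts G" "q \<in> verts G"
    then obtain u v where p: "p = ?C u" and q: "q = ?C v"
      by (auto simp: G_def cayley_graph_def snowflake_group_def carrier_presented_group)
    have "\<exists>r. pl_path G ?l (Vertex (?C [])) (Vertex (?C ([] @ u))) r"
      "\<exists>r. pl_path G ?l (Vertex (?C [])) (Vertex (?C ([] @ v))) r" by (rule walk)+
    then show "\<exists>r. pl_path G ?l (Vertex p) (Vertex q) r"
      using pl_path_rev[OF wf] pl_path_append by (fastforce simp: p q)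
  qed
qed

lemma mspace_snowflake_graph: "1 \<le> L \<Longrightarrow> mspace (snowflake_graph L) =
    graph_points (cayley_graph (snowflake_group L) (snowflake_elem L)) (snowflake_length L)"
  and mdist_snowflake_graph: "1 \<le> L \<Longrightarrow> mdist (snowflake_graph L) =
    graph_dist (cayley_graph (snowflake_group L) (snowflake_elem L)) (snowflake_length L)"
  by (simp_all add: snowflake_graph_def metric_graph_def Metric_space_snowflake
      Metric_space.mspace_metric Metric_space.mdist_metric)


section \<open>Asymptotic cones\<close>

definition nonprincipal_ultrafilter :: "'i filter \<Rightarrow> bool" where
  "nonprincipal_ultrafilter \<omega> \<longleftrightarrow>
    \<omega> \<noteq> bot \<and> (\<forall>P. eventually P \<omega> \<or> eventually (\<lambda>i. \<not> P i) \<omega>) \<and> (\<forall>i. \<omega> \<noteq> principal {i})"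

text \<open>The limit is taken in the compact space \<open>ereal\<close>, so that it exists for all sequences.\<close>

definition cone_dist ::
    "nat filter \<Rightarrow> 'a metric \<Rightarrow> (nat \<Rightarrow> real) \<Rightarrow> (nat \<Rightarrow> 'a) \<Rightarrow> (nat \<Rightarrow> 'a) \<Rightarrow> ereal" where
  "cone_dist \<omega> m s x y = Lim \<omega> (\<lambda>n. ereal (mdist m (x n) (y n) / s n))"

definition cone_seqs ::
    "nat filter \<Rightarrow> 'a metric \<Rightarrow> (nat \<Rightarrow> 'a) \<Rightarrow> (nat \<Rightarrow> real) \<Rightarrow> (nat \<Rightarrow> 'a) set" where
  "cone_seqs \<omega> m b s = {x. (\<forall>n. x n \<in> mspace m) \<and> cone_dist \<omega> m s b x < \<infinity>}"

definition cone_rel ::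
    "nat filter \<Rightarrow> 'a metric \<Rightarrow> (nat \<Rightarrow> 'a) \<Rightarrow> (nat \<Rightarrow> real) \<Rightarrow>
      ((nat \<Rightarrow> 'a) \<times> (nat \<Rightarrow> 'a)) set" where
  "cone_rel \<omega> m b s =
    {(x, y). x \<in> cone_seqs \<omega> m b s \<and> y \<in> cone_seqs \<omega> m b s \<and> cone_dist \<omega> m s x y = 0}"

definition cone_points ::
    "nat filter \<Rightarrow> 'a metric \<Rightarrow> (nat \<Rightarrow> 'a) \<Rightarrow> (nat \<Rightarrow> real) \<Rightarrow> (nat \<Rightarrow> 'a) set set" where
  "cone_points \<omega> m b s = cone_seqs \<omega> m b s // cone_rel \<omega> m b s"

definition cone_quotient_dist ::
    "nat filter \<Rightarrow> 'a metric \<Rightarrow> (nat \<Rightarrow> 'a) \<Rightarrow> (nat \<Rightarrow> real) \<Rightarrow>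
      (nat \<Rightarrow> 'a) set \<Rightarrow> (nat \<Rightarrow> 'a) set \<Rightarrow> real" where
  "cone_quotient_dist \<omega> m b s A B =
    (if A \<in> cone_points \<omega> m b s \<and> B \<in> cone_points \<omega> m b s
     then (THE r. \<forall>x\<in>A. \<forall>y\<in>B. cone_dist \<omega> m s x y = ereal r) else 0)"

definition asymptotic_cone ::
    "nat filter \<Rightarrow> 'a metric \<Rightarrow> (nat \<Rightarrow> 'a) \<Rightarrow> (nat \<Rightarrow> real) \<Rightarrow> (nat \<Rightarrow> 'a) set metric" where
  "asymptotic_cone \<omega> m b s = metric (cone_points \<omega> m b s, cone_quotient_dist \<omega> m b s)"

definition is_asymptotic_cone :: "'a metric \<Rightarrow> (nat \<Rightarrow> 'a) set metric \<Rightarrow> bool" where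
  "is_asymptotic_cone m C \<longleftrightarrow>
    (\<exists>\<omega> b s. nonprincipal_ultrafilter \<omega> \<and> (\<forall>n. b n \<in> mspace m) \<and>
      (\<forall>n. 0 < s n) \<and> filterlim s at_top sequentially \<and> C = asymptotic_cone \<omega> m b s)"

lemma ultrafilter_limit_exists:
  fixes f :: "'i \<Rightarrow> ereal"
  assumes "nonprincipal_ultrafilter \<omega>"
  shows "\<exists>l. (f \<longlongrightarrow> l) \<omega>"
proof -
  have "filtermap f \<omega> \<noteq> bot"
    using assms by (simp add: nonprincipal_ultrafilter_def filtermap_bot_iff)
  moreover have "compact (UNIV :: ereal set)" by (simp add: compact_UNIV)
  ultimately obtain l where l: "inf (nhds l) (filtermap f \<omega>) \<noteq> bot"
    by (auto simp: compact_filter)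
  have "eventually (\<lambda>i. f i \<in> S) \<omega>" if S: "open S" "l \<in> S" for S
  proof (rule ccontr)
    assume "\<not> ?thesis"
    then have "eventually (\<lambda>i. f i \<notin> S) \<omega>"
      using assms by (auto simp: nonprincipal_ultrafilter_def)
    then have "eventually (\<lambda>z. z \<notin> S) (filtermap f \<omega>)" by (simp add: eventually_filtermap)
    moreover have "eventually (\<lambda>z. z \<in> S) (nhds l)" using S by (rule eventually_nhds_in_open)
    ultimately have "eventually (\<lambda>_. False) (inf (nhds l) (filtermap f \<omega>))"
      unfolding eventually_inf by blast
    then show False using l by (simp add: trivial_limit_def)
  qed
  then show ?thesis by (auto simp: tendsto_def)
qed

lemma cone_dist_tendsto:
  assumes "nonprincipal_ultrafilter \<omega>"
  shows "((\<lambda>n. ereal (mdist m (x n) (y n) / s n)) \<longlongrightarrow> cone_dist \<omega> m s x y) \<omega>"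
proof -
  obtain l where l: "((\<lambda>n. ereal (mdist m (x n) (y n) / s n)) \<longlongrightarrow> l) \<omega>"
    using ultrafilter_limit_exists[OF assms] by blast
  then have "cone_dist \<omega> m s x y = l"
    using assms unfolding cone_dist_def by (intro tendsto_Lim) (auto simp: nonprincipal_ultrafilter_def)
  then show ?thesis using l by simp
qed

context
  fixes \<omega> :: "nat filter" and m :: "'a metric" and b :: "nat \<Rightarrow> 'a" and s :: "nat \<Rightarrow> real"
  assumes \<omega>: "nonprincipal_ultrafilter \<omega>" and s: "\<And>n. 0 < s n" and b: "\<And>n. b n \<in> mspace m"
begin

lemma cone_dist_commute: "cone_dist \<omega> m s x y = cone_dist \<omega> m s y x"
  by (simp add: cone_dist_def mdist_commute)

lemma cone_dist_nonneg: "0 \<le> cone_dist \<omega> m s x y"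
proof (rule tendsto_lowerbound[OF cone_dist_tendsto[OF \<omega>]])
  show "\<forall>\<^sub>F n in \<omega>. 0 \<le> ereal (mdist m (x n) (y n) / s n)"
    using s by (simp add: less_imp_le)
  show "\<omega> \<noteq> bot" using \<omega> by (simp add: nonprincipal_ultrafilter_def)
qed

lemma cone_dist_self:
  assumes "\<And>n. x n \<in> mspace m"
  shows "cone_dist \<omega> m s x x = 0"
proof -
  have "mdist m (x n) (x n) = 0" for n using assms by simp
  then show ?thesis
    unfolding cone_dist_def using \<omega>
    by (intro tendsto_Lim) (simp_all add: nonprincipal_ultrafilter_def zero_ereal_def)
qed

lemma cone_dist_triangle:
  assumes "\<And>n. x n \<in> mspace m" "\<And>n. y n \<in> mspace m" "\<And>n. z n \<in> mspace m"
  shows "cone_dist \<omega> m s x z \<le> cone_dist \<omega> m s x y + cone_dist \<omega> m s y z"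
proof (rule tendsto_le)
  show "\<omega> \<noteq> bot" using \<omega> by (simp add: nonprincipal_ultrafilter_def)
  show "((\<lambda>n. ereal (mdist m (x n) (z n) / s n)) \<longlongrightarrow> cone_dist \<omega> m s x z) \<omega>"
    by (rule cone_dist_tendsto[OF \<omega>])
  show "((\<lambda>n. ereal (mdist m (x n) (y n) / s n) + ereal (mdist m (y n) (z n) / s n))
      \<longlongrightarrow> cone_dist \<omega> m s x y + cone_dist \<omega> m s y z) \<omega>"
    using cone_dist_nonneg[of x y] cone_dist_nonneg[of y z]
    by (intro tendsto_add_ereal_general cone_dist_tendsto[OF \<omega>]) auto
  have "mdist m (x n) (z n) / s n \<le> mdist m (x n) (y n) / s n + mdist m (y n) (z n) / s n" for n
    using mdist_triangle[of "x n" m "y n" "z n"] assms s[of n]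
    by (simp add: divide_right_mono flip: add_divide_distrib)
  then show "\<forall>\<^sub>F n in \<omega>. ereal (mdist m (x n) (z n) / s n)
      \<le> ereal (mdist m (x n) (y n) / s n) + ereal (mdist m (y n) (z n) / s n)"
    by simp
qed

lemma cone_dist_finite:
  assumes "x \<in> cone_seqs \<omega> m b s" "y \<in> cone_seqs \<omega> m b s"
  obtains r where "cone_dist \<omega> m s x y = ereal r"
proof -
  have "cone_dist \<omega> m s x y \<le> cone_dist \<omega> m s x b + cone_dist \<omega> m s b y"
    using assms b by (intro cone_dist_triangle) (auto simp: cone_seqs_def)
  also have "\<dots> < \<infinity>"
    using assms by (simp add: cone_seqs_def cone_dist_commute[of x])
  finally show ?thesis
    using that cone_dist_nonneg[of x y] by (cases "cone_dist \<omega> m s x y") auto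
qed

lemma cone_dist_congruent:
  assumes "(x, x') \<in> cone_rel \<omega> m b s" "(y, y') \<in> cone_rel \<omega> m b s"
  shows "cone_dist \<omega> m s x' y' \<le> cone_dist \<omega> m s x y"
proof -
  have M: "x n \<in> mspace m" "x' n \<in> mspace m" "y n \<in> mspace m" "y' n \<in> mspace m" for n
    using assms by (auto simp: cone_rel_def cone_seqs_def)
  have "cone_dist \<omega> m s x' y' \<le> cone_dist \<omega> m s x' x + cone_dist \<omega> m s x y'"
    by (intro cone_dist_triangle M)
  also have "\<dots> = cone_dist \<omega> m s x y'"
    using assms by (simp add: cone_rel_def cone_dist_commute[of x'])
  also have "\<dots> \<le> cone_dist \<omega> m s x y + cone_dist \<omega> m s y y'"
    by (intro cone_dist_triangle M)
  also have "\<dots> = cone_dist \<omega> m s x y" using assms by (simp add: cone_rel_def)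
  finally show ?thesis .
qed

lemma equiv_cone_rel: "equiv (cone_seqs \<omega> m b s) (cone_rel \<omega> m b s)"
proof (rule equivI)
  show "refl_on (cone_seqs \<omega> m b s) (cone_rel \<omega> m b s)"
    by (auto simp: refl_on_def cone_rel_def cone_dist_self cone_seqs_def)
  show "cone_rel \<omega> m b s \<subseteq> cone_seqs \<omega> m b s \<times> cone_seqs \<omega> m b s" by (auto simp: cone_rel_def)
  show "sym (cone_rel \<omega> m b s)" by (auto simp: sym_def cone_rel_def cone_dist_commute)
  show "trans (cone_rel \<omega> m b s)"
  proof (rule transI)
    fix x y z assume *: "(x, y) \<in> cone_rel \<omega> m b s" "(y, z) \<in> cone_rel \<omega> m b s"
    then have "cone_dist \<omega> m s x z \<le> cone_dist \<omega> m s x y + cone_dist \<omega> m s y z"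
      by (intro cone_dist_triangle) (auto simp: cone_rel_def cone_seqs_def)
    then show "(x, z) \<in> cone_rel \<omega> m b s"
      using * cone_dist_nonneg[of x z] by (auto simp: cone_rel_def)
  qed
qed

lemma cone_quotient_dist_class:
  assumes "x \<in> cone_seqs \<omega> m b s" "y \<in> cone_seqs \<omega> m b s"
  shows "ereal (cone_quotient_dist \<omega> m b s (cone_rel \<omega> m b s `` {x}) (cone_rel \<omega> m b s `` {y}))
    = cone_dist \<omega> m s x y"
proof -
  let ?R = "cone_rel \<omega> m b s"
  obtain r where r: "cone_dist \<omega> m s x y = ereal r" using cone_dist_finite assms by blast
  have "cone_dist \<omega> m s x' y' = ereal r" if "x' \<in> ?R `` {x}" "y' \<in> ?R `` {y}" for x' y'
  proof -
    have "(x, x') \<in> ?R" "(y, y') \<in> ?R" "(x', x) \<in> ?R" "(y', y) \<in> ?R"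
      using that equiv_cone_rel by (auto simp: equiv_def dest: symD)
    then show ?thesis
      using r cone_dist_congruent by (metis order.antisym)
  qed
  moreover have "x \<in> ?R `` {x}" "y \<in> ?R `` {y}"
    using assms equiv_class_self[OF equiv_cone_rel] by auto
  ultimately have "(THE r. \<forall>x'\<in>?R `` {x}. \<forall>y'\<in>?R `` {y}. cone_dist \<omega> m s x' y' = ereal r) = r"
    using r by (intro the_equality) auto
  then show ?thesis
    using assms r by (simp add: cone_quotient_dist_def cone_points_def quotientI)
qed

lemma Metric_space_cone: "Metric_space (cone_points \<omega> m b s) (cone_quotient_dist \<omega> m b s)"
proof -
  let ?R = "cone_rel \<omega> m b s" and ?S = "cone_seqs \<omega> m b s"
  let ?d = "cone_quotient_dist \<omega> m b s"
  have pts: "\<exists>x\<in>?S. A = ?R `` {x}" if "A \<in> cone_points \<omega> m b s" for A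
    using that by (auto simp: cone_points_def quotient_def)
  note d = cone_quotient_dist_class
  show ?thesis
  proof
    fix A B
    show "0 \<le> ?d A B"
    proof (cases "A \<in> cone_points \<omega> m b s \<and> B \<in> cone_points \<omega> m b s")
      case True
      then obtain x y where "x \<in> ?S" "y \<in> ?S" "A = ?R `` {x}" "B = ?R `` {y}" using pts by meson
      then show ?thesis using d[of x y] cone_dist_nonneg[of x y] by (metis ereal_less_eq(5))
    qed (auto simp: cone_quotient_dist_def)
    show "?d A B = ?d B A"
    proof -
      have "(\<forall>x\<in>A. \<forall>y\<in>B. cone_dist \<omega> m s x y = ereal r) \<longleftrightarrow>
          (\<forall>x\<in>B. \<forall>y\<in>A. cone_dist \<omega> m s x y = ereal r)" for r
        using cone_dist_commute by metis
      then show ?thesis by (simp add: cone_quotient_dist_def)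
    qed
  next
    fix A B assume "A \<in> cone_points \<omega> m b s" "B \<in> cone_points \<omega> m b s"
    then obtain x y where xy: "x \<in> ?S" "y \<in> ?S" "A = ?R `` {x}" "B = ?R `` {y}" using pts by meson
    then have "?d A B = 0 \<longleftrightarrow> cone_dist \<omega> m s x y = 0"
      using d[of x y] by (metis ereal_eq_0(1))
    also have "\<dots> \<longleftrightarrow> A = B"
      using xy eq_equiv_class_iff[OF equiv_cone_rel xy(1,2)] by (auto simp: cone_rel_def)
    finally show "?d A B = 0 \<longleftrightarrow> A = B" .
  next
    fix A B C assume "A \<in> cone_points \<omega> m b s" "B \<in> cone_points \<omega> m b s" "C \<in> cone_points \<omega> m b s"
    then obtain x y z where xyz: "x \<in> ?S" "y \<in> ?S" "z \<in> ?S"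
      "A = ?R `` {x}" "B = ?R `` {y}" "C = ?R `` {z}" using pts by meson
    then have "ereal (?d A C) \<le> ereal (?d A B) + ereal (?d B C)"
      using cone_dist_triangle[of x y z] by (simp add: d cone_seqs_def)
    then show "?d A C \<le> ?d A B + ?d B C" by simp
  qed
qed

lemma mspace_asymptotic_cone: "mspace (asymptotic_cone \<omega> m b s) = cone_points \<omega> m b s"
  and mdist_asymptotic_cone: "mdist (asymptotic_cone \<omega> m b s) = cone_quotient_dist \<omega> m b s"
  by (simp_all add: asymptotic_cone_def Metric_space_cone
      Metric_space.mspace_metric Metric_space.mdist_metric)

end


section \<open>The unit length circle and isometric embeddings\<close>

text \<open>
  The circle of circumference 1, parametrised by arc length: \<open>frac (v - u)\<close> and \<open>frac (u - v)\<close>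
  are the lengths of the two arcs between \<open>u\<close> and \<open>v\<close>.
\<close>

definition arc_dist :: "real \<Rightarrow> real \<Rightarrow> real" where
  "arc_dist u v = min (frac (v - u)) (frac (u - v))"

definition unit_length_circle :: "real metric" where
  "unit_length_circle = metric ({0..<1}, arc_dist)"

lemma arc_dist_eq: "u \<in> {0..<1} \<Longrightarrow> v \<in> {0..<1} \<Longrightarrow> arc_dist u v = min \<bar>u - v\<bar> (1 - \<bar>u - v\<bar>)"
proof -
  assume *: "u \<in> {0..<1}" "v \<in> {0..<1}"
  have "frac z = (if 0 \<le> z then z else z + 1)" if "-1 < z" "z < 1" for z :: real
    using that by (auto simp: frac_eq frac_unique_iff)
  from this[of "u - v"] this[of "v - u"] * show ?thesis by (auto simp: arc_dist_def)
qed

lemma Metric_space_circle: "Metric_space {0..<1} arc_dist"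
proof
  fix u v w :: real
  show "0 \<le> arc_dist u v" by (simp add: arc_dist_def)
  show "arc_dist u v = arc_dist v u" by (simp add: arc_dist_def min.commute)
  assume "u \<in> {0..<1}" "v \<in> {0..<1}"
  then show "arc_dist u v = 0 \<longleftrightarrow> u = v" by (auto simp: arc_dist_eq min_def)
  assume "w \<in> {0..<1}"
  with \<open>u \<in> {0..<1}\<close> \<open>v \<in> {0..<1}\<close> show "arc_dist u w \<le> arc_dist u v + arc_dist v w"
    by (simp add: arc_dist_eq min_def abs_if)
qed

lemma mspace_unit_length_circle: "mspace unit_length_circle = {0..<1}"
  and mdist_unit_length_circle: "mdist unit_length_circle = arc_dist"
  by (simp_all add: unit_length_circle_def Metric_space_circle
      Metric_space.mspace_metric Metric_space.mdist_metric)

definition isometric_embedding :: "'a metric \<Rightarrow> 'b metric \<Rightarrow> ('a \<Rightarrow> 'b) \<Rightarrow> bool" where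
  "isometric_embedding m m' f \<longleftrightarrow>
    f ` mspace m \<subseteq> mspace m' \<and>
    (\<forall>x\<in>mspace m. \<forall>y\<in>mspace m. mdist m' (f x) (f y) = mdist m x y)"

end

theory Submission
  imports Defs "HOL-Real_Asymp.Real_Asymp"
begin

text \<open>
  The relations \<open>sas\<inverse> = x\<close>, \<open>tat\<inverse> = y\<close>, \<open>a\<^sup>L = xy\<close> give \<open>|a\<^bsup>Ln\<^esup>| \<le> 2|a\<^sup>n| + 4\<close>, and for
  \<open>m = L\<^sup>k\<close> the snowflake words for \<open>a\<^sup>m\<close>, of length \<open>5 \<cdot> 2\<^sup>k - 4\<close>, are geodesic. Replacing the sides of
  the parallelogram \<open>x\<^sup>m y\<^sup>m = y\<^sup>m x\<^sup>m\<close> by these geodesics gives a loop; since its arcs bound distances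
  from above, the loop is almost isometric as soon as antipodal points are almost as far apart as
  half its length. A path between antipodal points \<open>p\<close>, \<open>q\<close> leaves the branches of the Bass-Serre tree
  that contain them through lines \<open>\<langle>x\<rangle>\<close> or \<open>\<langle>y\<rangle>\<close>. The key estimate is that the distance from the point at
  proportion \<open>\<lambda>\<close> of the geodesic from \<open>1\<close> to \<open>a\<^sup>m\<close> to the point \<open>a\<^sup>u\<close> of its line is, up to an error
  linear in \<open>k\<close>, the affine function \<open>(1 - \<lambda>)|a\<^sup>u| + \<lambda>|a\<^bsup>m-u\<^esup>|\<close> of \<open>\<lambda>\<close>: the geodesic branches like the
  binary expansion of \<open>\<lambda>\<close>, and each branching averages the two functions. Hence the antipodal distance is
  at least \<open>|a\<^sup>m| + (|a\<^sup>u| + |a\<^bsup>m-u\<^esup>|) \<ge> 2|a\<^sup>m|\<close> up to that error, which disappears after rescaling.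
\<close>

section \<open>Word length in the vertex group\<close>

locale snowflake =
  fixes L :: nat
  assumes L6: "6 \<le> L"
begin

text \<open>
  The vertex group \<open>\<langle>a, x, y\<rangle>\<close> is \<open>\<int>\<^sup>2\<close>, with \<open>(p, q)\<close> standing for \<open>a\<^sup>p x\<^sup>q\<close>, so that \<open>y\<close> is \<open>(L, -1)\<close>. The rules
  \<open>x_power\<close> and \<open>y_power\<close> come from \<open>x\<^sup>k = s a\<^sup>k s\<inverse>\<close> and \<open>y\<^sup>k = t a\<^sup>k t\<inverse>\<close>; detours through \<open>s\<inverse>\<close> and \<open>t\<inverse>\<close>
  are left out, since they turn out not to shorten anything.
\<close>

inductive cost_le :: "int \<times> int \<Rightarrow> nat \<Rightarrow> bool" where
  zero: "cost_le (0, 0) 0"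
| unit: "\<bar>i\<bar> = 1 \<Longrightarrow> cost_le (i, 0) 1"
| add: "cost_le u m \<Longrightarrow> cost_le v n \<Longrightarrow> cost_le (u + v) (m + n)"
| x_power: "cost_le (k, 0) n \<Longrightarrow> cost_le (0, k) (n + 2)"
| y_power: "cost_le (k, 0) n \<Longrightarrow> cost_le (int L * k, - k) (n + 2)"

definition nu :: "int \<times> int \<Rightarrow> nat" where
  "nu v = (LEAST n. cost_le v n)"

abbreviation M :: "int \<Rightarrow> nat" where
  "M k \<equiv> nu (k, 0)"

lemma cost_le_neg: "cost_le v n \<Longrightarrow> cost_le (- v) n"
proof (induction rule: cost_le.induct)
  case (add u m v n)
  then show ?case using cost_le.add[of "- u" m "- v" n] by (simp add: algebra_simps)
next
  case (y_power k n)
  then show ?case using cost_le.y_power[of "- k" n] by simp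
next
  case (unit i)
  then show ?case using cost_le.unit[of "- i"] by simp
next
  case (x_power k n)
  then show ?case using cost_le.x_power[of "- k" n] by simp
qed (auto intro: cost_le.zero)

lemma cost_le_a: "cost_le (int n, 0) n"
proof (induction n)
  case (Suc n)
  then show ?case using cost_le.add[OF Suc cost_le.unit[of 1]] by (simp add: add.commute)
qed (auto intro: cost_le.zero)

lemma cost_le_a_int: "cost_le (i, 0) (nat \<bar>i\<bar>)"
  using cost_le_a[of "nat \<bar>i\<bar>"] cost_le_neg[OF cost_le_a[of "nat \<bar>i\<bar>"]]
  by (cases "0 \<le> i") auto

lemma cost_le_exists: "\<exists>n. cost_le v n"
proof -
  obtain p q where v: "v = (p, q)" by (cases v)
  have "cost_le ((p, 0) + (0, q)) (nat \<bar>p\<bar> + (nat \<bar>q\<bar> + 2))"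
    by (intro cost_le.add cost_le.x_power cost_le_a_int)
  then show ?thesis by (auto simp: v)
qed

lemma cost_le_nu: "cost_le v (nu v)"
  unfolding nu_def using cost_le_exists by (rule LeastI_ex)

lemma nu_le: "cost_le v n \<Longrightarrow> nu v \<le> n"
  unfolding nu_def by (rule Least_le)

lemma nu_zero [simp]: "nu (0, 0) = 0"
  using nu_le[OF cost_le.zero] by simp

lemma nu_add_le: "nu (u + v) \<le> nu u + nu v"
  by (intro nu_le cost_le.add cost_le_nu)

lemma nu_minus [simp]: "nu (- v) = nu v"
  using nu_le[OF cost_le_neg[OF cost_le_nu, of v]] nu_le[OF cost_le_neg[OF cost_le_nu, of "- v"]]
  by simp

lemma nu_diff_le: "nu (u - w) \<le> nu (u - v) + nu (v - w)"
  using nu_add_le[of "u - v" "v - w"] by simp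

lemma nu_diff_commute: "nu (u - v) = nu (v - u)"
  using nu_minus[of "u - v"] by simp

lemma M_minus: "M (- k) = M k"
  using nu_minus[of "(k, 0)"] by simp

lemma M_add_le: "M (i + j) \<le> M i + M j"
  using nu_add_le[of "(i, 0)" "(j, 0)"] by simp

lemma M_diff_le: "M (i - j) \<le> M i + M j"
  using M_add_le[of i "- j"] by (simp add: M_minus)

lemma M_le_abs: "int (M i) \<le> \<bar>i\<bar>"
  using nu_le[OF cost_le_a_int[of i]] by simp

text \<open>The cost of a power of \<open>x\<close> or \<open>y\<close> written as a single
  conjugate of a power of \<open>a\<close>; the zero case makes an absent block free in the
  decompositions below.\<close>

definition M' :: "int \<Rightarrow> nat" where
  "M' k = (if k = 0 then 0 else M k + 2)"

lemma M_le_M': "M k \<le> M' k"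
  by (simp add: M'_def)

lemma M'_le: "M' k \<le> M k + 2"
  by (simp add: M'_def)

lemma M'_add_le: "M' (i + j) \<le> M' i + M' j"
  using M_add_le[of i j] by (auto simp: M'_def)

text \<open>The vertex group is abelian and \<open>M'\<close> is subadditive, so all
  \<open>x\<close>-blocks can be merged into one block \<open>r\<close> and all
  \<open>y\<close>-blocks into one block \<open>q\<close> without raising the cost.\<close>

lemma cost_le_decompose:
  "cost_le v n \<Longrightarrow>
    \<exists>i r q. v = (i + int L * q, r - q) \<and> \<bar>i\<bar> + int (M' r) + int (M' q) \<le> int n"
proof (induction rule: cost_le.induct)
  case zero
  show ?case by (rule exI[of _ 0], rule exI[of _ 0], rule exI[of _ 0]) (simp add: M'_def)
next
  case (unit i)
  then show ?case
    by (intro exI[of _ i] exI[of _ 0]) (simp add: M'_def)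
next
  case (add u m v n)
  then obtain i r q i' r' q' where
    *: "u = (i + int L * q, r - q)" "\<bar>i\<bar> + int (M' r) + int (M' q) \<le> int m"
    "v = (i' + int L * q', r' - q')" "\<bar>i'\<bar> + int (M' r') + int (M' q') \<le> int n"
    by blast
  show ?case
    using * M'_add_le[of r r'] M'_add_le[of q q']
    by (intro exI[of _ "i + i'"] exI[of _ "r + r'"] exI[of _ "q + q'"])
       (auto simp: algebra_simps)
next
  case (x_power k n)
  then show ?case using nu_le[OF x_power.hyps] M'_le[of k]
    by (intro exI[of _ 0] exI[of _ k] exI[of _ 0]) (simp add: M'_def)
next
  case (y_power k n)
  then show ?case using nu_le[OF y_power.hyps] M'_le[of k]
    by (intro exI[of _ 0] exI[of _ 0] exI[of _ k]) (simp add: M'_def)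
qed

lemma nu_decompose:
  obtains i r q where "v = (i + int L * q, r - q)"
    "\<bar>i\<bar> + int (M' r) + int (M' q) \<le> int (nu v)"
  using cost_le_decompose[OF cost_le_nu] by blast

lemma M_L_le: "M (int L * k) \<le> 2 * M k + 4"
proof -
  have "cost_le ((0, k) + (int L * k, - k)) ((M k + 2) + (M k + 2))"
    by (intro cost_le.add cost_le.x_power cost_le.y_power cost_le_nu)
  then show ?thesis using nu_le by fastforce
qed

lemma M_le_L: "int (M n) \<le> \<bar>n - int L * h\<bar> + 2 * int (M h) + 4"
  using M_add_le[of "n - int L * h" "int L * h"] M_L_le[of h] M_le_abs[of "n - int L * h"] by simp

lemma abs_le_L_abs: "\<bar>q :: int\<bar> * 6 \<le> \<bar>int L * q\<bar>"
  using mult_right_mono[of 6 "int L" "\<bar>q\<bar>"] L6 by (simp add: abs_mult)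

text \<open>The recursion \<open>2 * M ?m + 4\<close> of \<open>M_L_le\<close> cannot be beaten: in
  an optimal decomposition both blocks have the same exponent \<open>q\<close>, and the leftover
  \<open>a\<close>-letters cost at least 6 for each unit of \<open>\<bar>?m - q\<bar>\<close>, while
  two units suffice to compare \<open>2 * M q\<close> with \<open>2 * M ?m\<close>.\<close>

lemma M_power_L_ge: "5 * 2 ^ k \<le> int (M (int L ^ k)) + 4"
proof (induction k)
  case 0
  have "M 1 \<noteq> 0"
  proof
    assume "M 1 = 0"
    then obtain i r q where "(1, 0) = (i + int L * q, r - q)" "\<bar>i\<bar> + int (M' r) + int (M' q) \<le> 0"
      using nu_decompose[of "(1, 0)"] by auto
    then show False by (auto simp: M'_def split: if_splits)
  qed
  then show ?case by simp
next
  case (Suc k)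
  let ?m = "int L ^ k"
  obtain i r q where "(int L ^ Suc k, 0) = (i + int L * q, r - q)"
    and *: "\<bar>i\<bar> + int (M' r) + int (M' q) \<le> int (M (int L ^ Suc k))"
    using nu_decompose .
  then have i: "i = int L * (?m - q)" and r: "r = q" by (auto simp: algebra_simps)
  have ab: "\<bar>?m - q\<bar> * 6 \<le> \<bar>i\<bar>" unfolding i by (rule abs_le_L_abs)
  have m: "int (M ?m) \<le> \<bar>?m - q\<bar> + int (M q)"
    using M_add_le[of "?m - q" q] M_le_abs[of "?m - q"] by simp
  have m2: "int (M ?m) \<le> ?m" using M_le_abs[of ?m] by simp
  have "?m \<ge> 1" using L6 by simp
  then have "2 * int (M ?m) + 4 \<le> int (M (int L ^ Suc k))"
  proof (cases "q = 0")
    case True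
    \<comment> \<open>Without blocks the 4 must come from \<open>a\<close>-letters alone:
      \<open>6 * ?m \<ge> 2 * ?m + 4\<close>, with equality at \<open>?m = 1\<close>.\<close>
    then have "?m * 6 \<le> \<bar>i\<bar>" using ab \<open>?m \<ge> 1\<close> by simp
    then show ?thesis using * m2 \<open>?m \<ge> 1\<close> by linarith
  next
    case False
    then have "int (M' q) = int (M q) + 2" by (simp add: M'_def)
    then have "\<bar>?m - q\<bar> * 6 + 2 * (int (M q) + 2) \<le> int (M (int L ^ Suc k))"
      using * ab unfolding r by simp
    moreover have "2 * m' + 4 \<le> G" if "X * 6 + 2 * (Q + 2) \<le> G" "m' \<le> X + Q" "0 \<le> X"
      for X Q G m' :: int using that by presburger
    ultimately show ?thesis using m abs_ge_zero[of "?m - q"] by blast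
  qed
  then show ?case using Suc by simp
qed

lemma M_power_L_ge_real: "5 * 2 ^ k - 4 \<le> real (M (int L ^ k))"
proof -
  have "real_of_int (5 * 2 ^ k) \<le> real_of_int (int (M (int L ^ k)) + 4)"
    using M_power_L_ge[of k] by (simp only: of_int_le_iff)
  then show ?thesis by simp
qed

end

section \<open>Normal forms\<close>

text \<open>
  A normal form \<open>\<tau>\<^sub>1 e\<^sub>1 \<dots> \<tau>\<^sub>n e\<^sub>n v\<close> of the double HNN extension is stored with the last syllable first; the
  \<open>e\<^sub>i\<close> are stable letters and the \<open>\<tau>\<^sub>i\<close> are given by exponents: powers of \<open>a\<close> represent the cosets of \<open>\<langle>x\<rangle>\<close>
  and \<open>\<langle>y\<rangle>\<close> (for \<open>s\<close> and \<open>t\<close>), powers of \<open>x\<close> those of \<open>\<langle>a\<rangle>\<close> (for \<open>s\<inverse>\<close> and \<open>t\<inverse>\<close>).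
\<close>

type_synonym syllable = "int \<times> snowflake_gen \<times> bool"
type_synonym state = "syllable list \<times> int \<times> int"

fun opp :: "snowflake_gen \<times> bool \<Rightarrow> snowflake_gen \<times> bool" where
  "opp (c, b) = (c, \<not> b)"

lemma opp_opp [simp]: "opp (opp e) = e"
  by (cases e) simp

fun reduced :: "syllable list \<Rightarrow> bool" where
  "reduced [] = True"
| "reduced [_] = True"
| "reduced ((i, e) # (j, e') # l) \<longleftrightarrow> \<not> (e' = opp e \<and> i = 0) \<and> reduced ((j, e') # l)"

lemma reduced_ConsD: "reduced (\<sigma> # l) \<Longrightarrow> reduced l"
  by (cases "(\<sigma> # l)" rule: reduced.cases) auto

lemma reduced_Cons_iff:
  "reduced ((i, e) # l) \<longleftrightarrow> reduced l \<and> \<not> (l \<noteq> [] \<and> snd (hd l) = opp e \<and> i = 0)"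
  by (cases l) auto

context snowflake
begin

text \<open>
  \<open>emb e i r\<close> is the coset representative with exponent \<open>i\<close> times the \<open>r\<close>-th power of the generator of the
  edge group of \<open>e\<close>; \<open>tau\<close> and \<open>ht\<close> recover \<open>i\<close> and \<open>r\<close>.
\<close>

fun tau :: "snowflake_gen \<times> bool \<Rightarrow> int \<times> int \<Rightarrow> int" where
  "tau (c, b) (p, q) = (if b then if c = Gen_s then p else p + int L * q else q)"

fun ht :: "snowflake_gen \<times> bool \<Rightarrow> int \<times> int \<Rightarrow> int" where
  "ht (c, b) (p, q) = (if b then if c = Gen_s then q else - q else p)"

fun emb :: "snowflake_gen \<times> bool \<Rightarrow> int \<Rightarrow> int \<Rightarrow> int \<times> int" where
  "emb (c, b) i r = (if b then if c = Gen_s then (i, r) else (i + int L * r, - r) else (r, i))"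

lemma emb_tau_ht [simp]: "emb e (tau e v) (ht e v) = v"
  by (cases e; cases v) auto

lemma tau_emb [simp]: "tau e (emb e i r) = i"
  and ht_emb [simp]: "ht e (emb e i r) = r"
  by (cases e; auto)+

lemma emb_diff: "emb e i r - emb e i' r' = emb e (i - i') (r - r')"
  by (cases e) (auto simp: algebra_simps)

text \<open>Right multiplication of a normal form by the stable letter \<open>e\<close>; the first
  branch is Britton's pinch, after which the representative stored in the removed syllable is
  multiplied back.\<close>

definition cross :: "snowflake_gen \<times> bool \<Rightarrow> state \<Rightarrow> state" where
  "cross e p = (case p of (l, v) \<Rightarrow>
     if l \<noteq> [] \<and> snd (hd l) = opp e \<and> tau e v = 0 then (tl l, emb (opp e) (fst (hd l)) (ht e v))
     else ((tau e v, e) # l, emb (opp e) 0 (ht e v)))"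

lemma cross_cases:
  obtains (pop) i l' where "l = (i, opp e) # l'" "tau e v = 0"
    "cross e (l, v) = (l', emb (opp e) i (ht e v))"
  | (push) "\<not> (l \<noteq> [] \<and> snd (hd l) = opp e \<and> tau e v = 0)"
    "cross e (l, v) = ((tau e v, e) # l, emb (opp e) 0 (ht e v))"
proof (cases "l \<noteq> [] \<and> snd (hd l) = opp e \<and> tau e v = 0")
  case True
  then obtain i l' where "l = (i, opp e) # l'" by (cases l) auto
  then show ?thesis using that(1) True by (simp add: cross_def)
next
  case False
  then show ?thesis using that(2) by (auto simp: cross_def)
qed

section \<open>The action of words on normal forms\<close>

fun shift :: "snowflake_gen \<Rightarrow> int \<times> int" where
  "shift Gen_a = (1, 0)"
| "shift Gen_x = (0, 1)"
| "shift Gen_y = (int L, - 1)"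
| "shift _ = (0, 0)"

fun act1 :: "snowflake_gen \<times> bool \<Rightarrow> state \<Rightarrow> state" where
  "act1 (c, b) (l, v) =
    (if c = Gen_s \<or> c = Gen_t then cross (c, b) (l, v)
     else (l, if b then v + shift c else v - shift c))"

definition act :: "snowflake_gen word \<Rightarrow> state \<Rightarrow> state" where
  "act w = fold act1 w"

lemma act_Nil [simp]: "act [] p = p"
  and act_Cons: "act (g # w) p = act w (act1 g p)"
  and act_append: "act (u @ w) p = act w (act u p)"
  by (simp_all add: act_def)

lemma reduced_cross:
  assumes "reduced l"
  shows "reduced (fst (cross e (l, v)))"
proof (cases rule: cross_cases[of l e v])
  case (pop i l')
  then show ?thesis using assms by (metis fst_conv reduced_ConsD)
next
  case push
  then show ?thesis using assms by (simp add: reduced_Cons_iff)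
qed

lemma reduced_act1: "reduced (fst p) \<Longrightarrow> reduced (fst (act1 g p))"
  by (cases g; cases p) (auto intro: reduced_cross)

lemma reduced_act: "reduced (fst p) \<Longrightarrow> reduced (fst (act w p))"
  by (induction w arbitrary: p) (auto simp: act_Cons reduced_act1)

lemma cross_cross:
  assumes "reduced l"
  shows "cross (opp e) (cross e (l, v)) = (l, v)"
proof (cases rule: cross_cases[of l e v])
  case (pop i l')
  then have "\<not> (l' \<noteq> [] \<and> snd (hd l') = e \<and> i = 0)"
    using assms by (simp add: reduced_Cons_iff)
  moreover have "emb e 0 (ht e v) = v" using pop(2) emb_tau_ht[of e v] by simp
  ultimately show ?thesis unfolding pop(3)
    by (simp only: cross_def split tau_emb ht_emb opp_opp if_False pop(1))
next
  case push
  then show ?thesis by (simp add: cross_def)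
qed

lemma act1_cancel: "reduced (fst p) \<Longrightarrow> act1 (c, \<not> b) (act1 (c, b) p) = p"
  using cross_cross[of "fst p" "(c, b)" "snd p"]
  by (cases p; cases "cross (c, b) p") auto

text \<open>The relations \<open>x s = s a\<close> and \<open>y t = t a\<close>: \<open>D\<close>
  generates the edge group, so it leaves \<open>tau\<close> alone and raises \<open>ht\<close> by
  one, in both branches of \<open>cross\<close>.\<close>

lemma cross_line:
  assumes "c = Gen_s \<or> c = Gen_t"
  defines "D \<equiv> shift (if c = Gen_s then Gen_x else Gen_y)"
  shows "act1 (Gen_a, True) (cross (c, True) (l, v)) = cross (c, True) (l, v + D)"
  using assms by (cases v) (auto simp: cross_def algebra_simps)

definition total_shift :: "snowflake_gen word \<Rightarrow> int \<times> int" where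
  "total_shift w = sum_list (map (\<lambda>(c, b). if b then shift c else - shift c) w)"

lemma total_shift_simps:
  "total_shift [] = 0"
  "total_shift ((c, b) # w) = (if b then shift c else - shift c) + total_shift w"
  "total_shift (u @ w) = total_shift u + total_shift w"
  by (auto simp: total_shift_def)

lemma total_shift_replicate_a: "total_shift (replicate n (Gen_a, True)) = (int n, 0)"
  by (induction n) (simp_all add: total_shift_simps zero_prod_def)

lemma act_total_shift:
  "fst ` set w \<subseteq> {Gen_a, Gen_x, Gen_y} \<Longrightarrow> act w (l, v) = (l, v + total_shift w)"
proof (induction w arbitrary: v)
  case (Cons g w)
  obtain c b where g: "g = (c, b)" by (cases g)
  have "c \<noteq> Gen_s" "c \<noteq> Gen_t" using Cons.prems by (auto simp: g)
  then show ?case using Cons by (auto simp: g act_Cons total_shift_simps algebra_simps)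
qed (simp add: total_shift_simps)

lemma concat_replicate_singleton: "concat (replicate n [x]) = replicate n x"
  by (induction n) auto

text \<open>The conjugation relations hold by crossing, moving along the line and crossing back; the
  others only translate the vertex group, so their total shifts decide.\<close>

lemma act_relation:
  assumes "(u, w) \<in> snowflake_relations L" "reduced (fst p)"
  shows "act u p = act w p"
proof -
  obtain l v where p: "p = (l, v)" by (cases p)
  have s: "act [(c, True), (Gen_a, True), (c, False)] p = (l, v + shift (if c = Gen_s then Gen_x else Gen_y))"
    if "c = Gen_s \<or> c = Gen_t" for c
  proof -
    have "act [(c, True), (Gen_a, True), (c, False)] p
        = act1 (c, False) (act1 (Gen_a, True) (cross (c, True) (l, v)))"
      using that by (simp add: act_Cons p)
    also have "\<dots> = cross (opp (c, True)) (cross (c, True) (l, v + shift (if c = Gen_s then Gen_x else Gen_y)))"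
      unfolding cross_line[OF that]
      using that by (cases "cross (c, True) (l, v + shift (if c = Gen_s then Gen_x else Gen_y))") auto
    finally show ?thesis using assms(2) cross_cross[of l "(c, True)"] by (simp add: p)
  qed
  have abelian: "act u p = act w p"
    if "fst ` set u \<union> fst ` set w \<subseteq> {Gen_a, Gen_x, Gen_y}" "total_shift u = total_shift w" for u w
    using that by (simp add: act_total_shift p)
  consider "u = [(Gen_s, True), (Gen_a, True), (Gen_s, False)]" "w = [(Gen_x, True)]"
    | "u = [(Gen_t, True), (Gen_a, True), (Gen_t, False)]" "w = [(Gen_y, True)]"
    | "fst ` set u \<union> fst ` set w \<subseteq> {Gen_a, Gen_x, Gen_y}" "total_shift u = total_shift w"
    using assms(1)
    by (auto simp: snowflake_relations_def Let_def word_inv_def word_comm_def total_shift_simps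
        concat_replicate_singleton total_shift_replicate_a zero_prod_def set_replicate_conv_if)
  then show ?thesis
  proof cases
    case 1
    then show ?thesis using s[of Gen_s] by (simp add: p act_Cons)
  next
    case 2
    then show ?thesis using s[of Gen_t] by (simp add: p act_Cons)
  next
    case 3
    then show ?thesis by (rule abelian)
  qed
qed

lemma act_pres_eq:
  "pres_eq (snowflake_relations L) u w \<Longrightarrow> reduced (fst p) \<Longrightarrow> act u p = act w p"
proof (induction arbitrary: p rule: pres_eq.induct)
  case (append u u' v v')
  then show ?case by (simp add: act_append reduced_act)
next
  case (cancel g b)
  then show ?case by (simp add: act_Cons act1_cancel)
qed (auto simp: act_relation)


section \<open>Lower bounds for word length\<close>

lemma nu_x_le: "nu (0, k) \<le> M k + 2"
  and nu_y_le: "nu (int L * k, - k) \<le> M k + 2"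
  by (intro nu_le cost_le.intros cost_le_nu)+

lemma M_le_nu_x: "M k \<le> nu (0, k) + 2"
proof -
  obtain i r q where *: "(0, k) = (i + int L * q, r - q)"
    "\<bar>i\<bar> + int (M' r) + int (M' q) \<le> int (nu (0, k))"
    using nu_decompose .
  then have "i = - (int L * q)" "k = r - q" by auto
  then have "M k \<le> M r + M q" using M_diff_le by simp
  then show ?thesis using * M_le_M'[of r] M_le_M'[of q] by linarith
qed

lemma M_le_nu_y: "M k \<le> nu (int L * k, - k) + 2"
proof -
  obtain i r q where *: "(int L * k, - k) = (i + int L * q, r - q)"
    "\<bar>i\<bar> + int (M' r) + int (M' q) \<le> int (nu (int L * k, - k))"
    using nu_decompose .
  then have "k = q - r" by auto
  then have "M k \<le> M q + M r" using M_diff_le by simp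
  then show ?thesis using * M_le_M'[of r] M_le_M'[of q] by linarith
qed

lemma emb_minus_emb: "emb e i r - emb e i r' = emb e 0 (r - r')"
  by (simp add: emb_diff)

text \<open>The edge group has length \<open>M\<close> on the side of \<open>a\<close> and a length
  within 2 of \<open>M\<close> on the side of \<open>x\<close> or \<open>y\<close>. The slack 2
  matches one crossing there and back, which is why detours through inverse stable letters shorten
  nothing.\<close>

lemma nu_emb_opp: "nu (emb (opp e) 0 r) \<le> nu (emb e 0 r) + 2"
proof -
  obtain c b where "e = (c, b)" by (cases e)
  then show ?thesis
    using nu_x_le[of r] nu_y_le[of r] M_le_nu_x[of r] M_le_nu_y[of r] by auto
qed

text \<open>
  Extends a function \<open>f\<close> on the root coset, 1-Lipschitz for \<open>nu\<close>, to a 1-Lipschitz function on all normal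
  forms, as distance functions extend: every path into a branch crosses the line where it is attached.
\<close>

fun branch_dist :: "(int \<times> int \<Rightarrow> nat) \<Rightarrow> syllable list \<Rightarrow> int \<times> int \<Rightarrow> nat" where
  "branch_dist f [] v = f v"
| "branch_dist f ((i, e) # l) v = (INF r. branch_dist f l (emb e i r) + 1 + nu (v - emb (opp e) 0 r))"

lemma branch_dist_Cons_le: "branch_dist f ((i, e) # l) v \<le> branch_dist f l (emb e i r) + 1 + nu (v - emb (opp e) 0 r)"
  unfolding branch_dist.simps by (rule cINF_lower) simp_all

lemma branch_dist_Cons_attained:
  "\<exists>r. branch_dist f ((i, e) # l) v = branch_dist f l (emb e i r) + 1 + nu (v - emb (opp e) 0 r)"
proof -
  have "Inf (range (\<lambda>r. branch_dist f l (emb e i r) + 1 + nu (v - emb (opp e) 0 r)))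
      \<in> range (\<lambda>r. branch_dist f l (emb e i r) + 1 + nu (v - emb (opp e) 0 r))"
    by (rule Inf_nat_def1) simp
  then show ?thesis by auto
qed

context
  fixes f :: "int \<times> int \<Rightarrow> nat"
  assumes lip: "\<And>u v. f u \<le> f v + nu (u - v)"
begin

lemma branch_dist_lip: "branch_dist f l u \<le> branch_dist f l v + nu (u - v)"
proof (cases l)
  case Nil
  then show ?thesis by (simp add: lip)
next
  case (Cons \<sigma> l')
  obtain i e where \<sigma>: "\<sigma> = (i, e)" by (cases \<sigma>)
  obtain r where "branch_dist f ((i, e) # l') v = branch_dist f l' (emb e i r) + 1 + nu (v - emb (opp e) 0 r)"
    using branch_dist_Cons_attained by blast
  then show ?thesis
    using branch_dist_Cons_le[of f i e l' u r] nu_diff_le[of u "emb (opp e) 0 r" v]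
    unfolding Cons \<sigma> by linarith
qed

lemma branch_dist_push_le: "branch_dist f ((i, e) # l) (emb (opp e) 0 r) \<le> branch_dist f l (emb e i r) + 1"
  using branch_dist_Cons_le[of f i e l "emb (opp e) 0 r" r] by (simp add: zero_prod_def)

text \<open>The optimal route may enter the branch at another point \<open>r'\<close> of the line.
  Walking from \<open>r'\<close> to \<open>r\<close> outside the branch instead costs at most 2
  more, which is covered by the saved crossing and the 1 allowed here.\<close>

lemma branch_dist_pop_le: "branch_dist f l (emb e i r) \<le> branch_dist f ((i, e) # l) (emb (opp e) 0 r) + 1"
proof -
  obtain r' where "branch_dist f ((i, e) # l) (emb (opp e) 0 r)
      = branch_dist f l (emb e i r') + 1 + nu (emb (opp e) 0 (r - r'))"
    using branch_dist_Cons_attained[of f i e l "emb (opp e) 0 r"] by (auto simp: emb_minus_emb)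
  then show ?thesis
    using branch_dist_lip[of l "emb e i r" "emb e i r'"] nu_emb_opp[of "opp e" "r - r'"]
    by (simp add: emb_minus_emb)
qed

lemma branch_dist_cross:
  "branch_dist f (fst (cross e (l, v))) (snd (cross e (l, v))) \<le> branch_dist f l v + 1"
  "branch_dist f l v \<le> branch_dist f (fst (cross e (l, v))) (snd (cross e (l, v))) + 1"
proof -
  have "branch_dist f (fst (cross e (l, v))) (snd (cross e (l, v))) \<le> branch_dist f l v + 1 \<and>
    branch_dist f l v \<le> branch_dist f (fst (cross e (l, v))) (snd (cross e (l, v))) + 1"
  proof (cases rule: cross_cases[of l e v])
    case (pop i l')
    have v: "v = emb e 0 (ht e v)" using pop(2) emb_tau_ht[of e v] by simp
    show ?thesis unfolding pop(3)
      using branch_dist_pop_le[of l' "opp e" i "ht e v"] branch_dist_push_le[of i "opp e" l' "ht e v"]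
      by (simp add: pop(1) v[symmetric] del: branch_dist.simps)
  next
    case push
    show ?thesis unfolding push(2)
      using branch_dist_pop_le[of l e "tau e v" "ht e v"] branch_dist_push_le[of "tau e v" e l "ht e v"]
      by (simp del: branch_dist.simps)
  qed
  then show "branch_dist f (fst (cross e (l, v))) (snd (cross e (l, v))) \<le> branch_dist f l v + 1"
    "branch_dist f l v \<le> branch_dist f (fst (cross e (l, v))) (snd (cross e (l, v))) + 1" by auto
qed

end

section \<open>Path length and passage through the root coset\<close>

fun letter_cost :: "snowflake_gen \<times> bool \<Rightarrow> nat" where
  "letter_cost (c, b) = (if c \<in> {Gen_x, Gen_y} then L else 1)"

definition word_cost :: "snowflake_gen word \<Rightarrow> nat" where
  "word_cost w = sum_list (map letter_cost w)"

lemma word_cost_simps [simp]: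
  "word_cost [] = 0" "word_cost (g # w) = letter_cost g + word_cost w"
  "word_cost (u @ w) = word_cost u + word_cost w"
  by (simp_all add: word_cost_def)

lemma nu_shift_le: "c \<noteq> Gen_s \<Longrightarrow> c \<noteq> Gen_t \<Longrightarrow> nu (shift c) \<le> letter_cost (c, b)"
  using nu_x_le[of 1] nu_y_le[of 1] M_le_abs[of 1] L6 by (cases c) auto

lemma branch_dist_act1:
  assumes lip: "\<And>u v. f u \<le> f v + nu (u - v)"
  shows "branch_dist f (fst (act1 g p)) (snd (act1 g p)) \<le> branch_dist f (fst p) (snd p) + letter_cost g"
    and "branch_dist f (fst p) (snd p) \<le> branch_dist f (fst (act1 g p)) (snd (act1 g p)) + letter_cost g"
proof -
  obtain c b l v where [simp]: "g = (c, b)" "p = (l, v)" by (cases g; cases p) auto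
  have "branch_dist f (fst (act1 g p)) (snd (act1 g p)) \<le> branch_dist f (fst p) (snd p) + letter_cost g \<and>
    branch_dist f (fst p) (snd p) \<le> branch_dist f (fst (act1 g p)) (snd (act1 g p)) + letter_cost g"
  proof (cases "c = Gen_s \<or> c = Gen_t")
    case True
    then show ?thesis using branch_dist_cross[OF lip, where e = "(c, b)" and l = l and v = v] by auto
  next
    case False
    define u where "u = (if b then v + shift c else v - shift c)"
    have "nu (u - v) = nu (shift c)" "nu (v - u) = nu (shift c)" by (simp_all add: u_def)
    then show ?thesis
      using False branch_dist_lip[OF lip, of l u v] branch_dist_lip[OF lip, of l v u] nu_shift_le[of c b]
      by (simp add: u_def del: letter_cost.simps)
  qed
  then show "branch_dist f (fst (act1 g p)) (snd (act1 g p)) \<le> branch_dist f (fst p) (snd p) + letter_cost g"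
    "branch_dist f (fst p) (snd p) \<le> branch_dist f (fst (act1 g p)) (snd (act1 g p)) + letter_cost g" by auto
qed

lemma branch_dist_act:
  assumes lip: "\<And>u v. f u \<le> f v + nu (u - v)"
  shows "branch_dist f (fst (act w p)) (snd (act w p)) \<le> branch_dist f (fst p) (snd p) + word_cost w"
    and "branch_dist f (fst p) (snd p) \<le> branch_dist f (fst (act w p)) (snd (act w p)) + word_cost w"
proof (induction w arbitrary: p)
  case (Cons g w)
  {
    case 1
    then show ?case using Cons(1)[of "act1 g p"] branch_dist_act1(1)[OF lip, of g p]
      by (simp add: act_Cons del: letter_cost.simps)
  next
    case 2
    then show ?case using Cons(2)[of "act1 g p"] branch_dist_act1(2)[OF lip, of p g]
      by (simp add: act_Cons del: letter_cost.simps)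
  }
qed auto

abbreviation dist_to :: "int \<times> int \<Rightarrow> int \<times> int \<Rightarrow> nat" where
  "dist_to \<alpha> \<equiv> \<lambda>v. nu (v - \<alpha>)"

lemma dist_to_lip: "dist_to \<alpha> u \<le> dist_to \<alpha> v + nu (u - v)"
  using nu_diff_le[of u \<alpha> v] by simp

lemma act1_fst_cases:
  obtains "fst (act1 g p) = fst p" | \<sigma> where "fst (act1 g p) = \<sigma> # fst p"
  | \<sigma> where "fst p = \<sigma> # fst (act1 g p)"
proof -
  obtain c b l v where gp: "g = (c, b)" "p = (l, v)" by (cases g; cases p) auto
  show ?thesis
  proof (cases "c = Gen_s \<or> c = Gen_t")
    case True
    then have "act1 g p = cross (c, b) (l, v)" by (auto simp: gp)
    then show ?thesis
      using that by (cases rule: cross_cases[of l "(c, b)" v]) (auto simp: gp)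
  next
    case False
    then show ?thesis using that by (auto simp: gp)
  qed
qed

text \<open>A letter changes the syllable list only at its head, so the last entry, which names the
  branch at the root, can be replaced only after the list has become empty.\<close>

lemma act_through_root:
  assumes "fst p \<noteq> []" "fst (act w p) = [] \<or> last (fst (act w p)) \<noteq> last (fst p)"
  shows "\<exists>w1 w2 \<alpha>. w = w1 @ w2 \<and> act w1 p = ([], \<alpha>)"
  using assms
proof (induction w arbitrary: p)
  case Nil
  then show ?case by simp
next
  case (Cons g w)
  show ?case
  proof (cases "fst (act1 g p) = []")
    case True
    then have "act [g] p = ([], snd (act1 g p))" by (metis act_Cons act_Nil prod.collapse)
    then show ?thesis by (metis append_Cons append_Nil)
  next
    case False
    then have "last (fst (act1 g p)) = last (fst p)"
      using Cons.prems(1) by (cases rule: act1_fst_cases[of g p]) auto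
    then obtain w1 w2 \<alpha> where "w = w1 @ w2" "act w1 (act1 g p) = ([], \<alpha>)"
      using Cons.IH[of "act1 g p"] False Cons.prems by (auto simp: act_Cons)
    then show ?thesis by (metis act_Cons append_Cons)
  qed
qed

lemma word_cost_ge_through_root:
  assumes "fst p \<noteq> []" "fst (act w p) \<noteq> []" "last (fst (act w p)) \<noteq> last (fst p)"
  shows "\<exists>\<alpha>. branch_dist (dist_to \<alpha>) (fst p) (snd p) + branch_dist (dist_to \<alpha>) (fst (act w p)) (snd (act w p))
    \<le> word_cost w"
proof -
  obtain w1 w2 \<alpha> where w: "w = w1 @ w2" and \<alpha>: "act w1 p = ([], \<alpha>)"
    using act_through_root assms by blast
  have "branch_dist (dist_to \<alpha>) (fst p) (snd p) \<le> word_cost w1"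
    using branch_dist_act(2)[OF dist_to_lip, of \<alpha> p w1] \<alpha> by (simp add: zero_prod_def)
  moreover have "branch_dist (dist_to \<alpha>) (fst (act w p)) (snd (act w p)) \<le> word_cost w2"
    using branch_dist_act(1)[OF dist_to_lip, of \<alpha> w2 "([], \<alpha>)"] \<alpha>
    by (simp add: zero_prod_def w act_append)
  ultimately show ?thesis unfolding w word_cost_simps by (intro exI[of _ \<alpha>]) simp
qed

end

section \<open>The affine estimate along the geodesic\<close>

lemma affine_aux:
  fixes t :: real
  assumes "0 \<le> t" "t \<le> 1" "a1 \<le> d + 2 * h + 4" "a2 \<le> d + 2 * h' + 4" "h \<le> s + r" "h' \<le> s + r'"
  shows "(1 - t / 2) * a1 + t / 2 * a2 \<le> d + s + h + (1 - t) * r + t * r' + 4"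
proof -
  \<comment> \<open>Of the total weight \<open>2 - t\<close> of \<open>h\<close> one unit is kept
    and only \<open>1 - t\<close> is estimated further; with the weight \<open>t\<close> of
    \<open>h'\<close> the copies of \<open>s\<close> add up to exactly one.\<close>
  have "(1 - t / 2) * a1 \<le> (1 - t / 2) * (d + 2 * h + 4)" "t / 2 * a2 \<le> t / 2 * (d + 2 * h' + 4)"
    "(1 - t) * h \<le> (1 - t) * (s + r)" "t * h' \<le> t * (s + r')"
    using assms by (intro mult_left_mono; simp)+
  then show ?thesis by (simp add: algebra_simps)
qed

lemma affine_aux_antipodal:
  fixes t :: real
  assumes "0 \<le> t" "0 \<le> \<epsilon>" "t + \<epsilon> \<le> 1" "0 \<le> r" "r \<le> z + r'" "s \<le> z + s'"
  shows "(1 - \<epsilon>) * (r + s) \<le> z + (1 - t) * r + t * s + (t + \<epsilon>) * r' + (1 - t - \<epsilon>) * s'"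
proof -
  \<comment> \<open>The missing weights of \<open>r\<close> and \<open>s\<close> are borrowed from
    \<open>r'\<close> and \<open>s'\<close>; the weights of these transfers sum to one, so a single
    \<open>z\<close> pays for both.\<close>
  have "(t + \<epsilon>) * r \<le> (t + \<epsilon>) * (z + r')" "(1 - t - \<epsilon>) * s \<le> (1 - t - \<epsilon>) * (z + s')"
    "0 \<le> \<epsilon> * r"
    using assms by (intro mult_left_mono mult_nonneg_nonneg; simp)+
  then show ?thesis by (simp add: algebra_simps)
qed

context snowflake
begin

text \<open>One form of \<open>nu_decompose\<close> for both kinds of lines: \<open>r + h\<close> is
  the exponent of the block along the line and \<open>h\<close> that of the block of the other
  generator.\<close>

lemma nu_line:
  assumes "c = Gen_s \<or> c = Gen_t"
  shows "\<exists>h. real_of_int \<bar>i - int L * h\<bar> + M (r + h) + M h \<le> nu (emb (c, True) i r)"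
proof -
  obtain i0 r0 q where *: "emb (c, True) i r = (i0 + int L * q, r0 - q)"
    "\<bar>i0\<bar> + int (M' r0) + int (M' q) \<le> int (nu (emb (c, True) i r))"
    using nu_decompose .
  have M: "real_of_int \<bar>i0\<bar> + M r0 + M q \<le> nu (emb (c, True) i r)"
    using *(2) M_le_M'[of r0] M_le_M'[of q] by linarith
  show ?thesis
  proof (cases "c = Gen_s")
    case True
    then have i0: "i0 = i - int L * q" and r0: "r0 = r + q" using *(1) by simp_all
    show ?thesis using M unfolding i0 r0 by (rule exI[of _ q])
  next
    case False
    then have r0: "r0 = q - r" and "i + int L * r = i0 + int L * q" using *(1) by simp_all
    then have i0: "i0 = i - int L * (q - r)" by (simp add: algebra_simps)
    show ?thesis using M unfolding i0 r0 by (intro exI[of _ "q - r"]) simp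
  qed
qed

text \<open>
  The initial vertex of the \<open>j\<close>-th of the \<open>2\<^sup>k\<close> \<open>a\<close>-edges of the snowflake geodesic from \<open>a\<^sup>c\<close> to \<open>a\<^bsup>c+m\<^esup>\<close>,
  \<open>m = L\<^sup>k\<close>, in the coset \<open>l\<close>. The second half is translated by \<open>-L\<^bsup>k-1\<^esup>\<close> because the coset of its line
  is represented by a power of \<open>a\<close>.
\<close>

fun geodesic_point :: "nat \<Rightarrow> int \<Rightarrow> nat \<Rightarrow> syllable list \<Rightarrow> state" where
  "geodesic_point 0 c j l = (l, c, 0)"
| "geodesic_point (Suc k) c j l =
    (if j < 2 ^ k then geodesic_point k 0 j ((c, Gen_s, True) # l)
     else geodesic_point k (- (int L ^ k)) (j - 2 ^ k) ((c + int L ^ Suc k, Gen_t, True) # l))"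

abbreviation branch_dist_state :: "(int \<times> int \<Rightarrow> nat) \<Rightarrow> state \<Rightarrow> nat" where
  "branch_dist_state f p \<equiv> branch_dist f (fst p) (snd p)"

text \<open>Supplies the hypothesis of \<open>branch_dist_geodesic_point\<close> one coset deeper:
  the branch is left at the point \<open>r\<close> of its line, and the 1 is the stable
  letter.\<close>

lemma branch_dist_branch:
  "\<exists>r. real (branch_dist f l (emb (e, True) i r)) + 1 + nu (\<beta> - (r, 0)) \<le> branch_dist f ((i, e, True) # l) \<beta>"
proof -
  obtain r where "branch_dist f ((i, e, True) # l) \<beta>
      = branch_dist f l (emb (e, True) i r) + 1 + nu (\<beta> - emb (opp (e, True)) 0 r)"
    using branch_dist_Cons_attained by blast
  then show ?thesis by (intro exI[of _ r]) (simp del: branch_dist.simps)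
qed

lemma M_le_L_real: "real (M n) \<le> real_of_int \<bar>n - int L * h\<bar> + 2 * real (M h) + 4"
  using M_le_L[of n h] by linarith

text \<open>Here \<open>g\<close> stands for whatever distance lies beyond the line, so the
  induction hypothesis can be used in the next coset with the distance from the line there as the
  new \<open>g\<close>. Each level loses at most 4, the constant of \<open>M_L_le\<close>.\<close>

lemma branch_dist_geodesic_point:
  assumes "j < 2 ^ k" and "\<And>\<beta>. \<exists>u. g u + real (nu (\<beta> - (u, 0))) \<le> branch_dist f l \<beta>"
  shows "\<exists>u. g u + (1 - j / 2 ^ k) * M (u - c) + j / 2 ^ k * M (c + int L ^ k - u) - 4 * real k
    \<le> branch_dist_state f (geodesic_point k c j l)"
  using assms
proof (induction k arbitrary: c j l g)
  case 0
  obtain u where "g u + real (nu ((c, 0) - (u, 0))) \<le> branch_dist f l (c, 0)" using 0 by blast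
  then show ?case using 0(1) M_minus[of "c - u"] by (intro exI[of _ u]) simp
next
  case (Suc k)
  let ?m = "int L ^ k"
  show ?case
  proof (cases "j < 2 ^ k")
    case True
    define t :: real where "t = j / 2 ^ k"
    have t: "0 \<le> t" "t \<le> 1" using True by (simp_all add: t_def)
    obtain r where r: "real (branch_dist f l (emb (Gen_s, True) c r)) + 1 + (1 - t) * M r + t * M (?m - r) - 4 * real k
        \<le> branch_dist_state f (geodesic_point k 0 j ((c, Gen_s, True) # l))"
      using Suc.IH[OF True, where g = "\<lambda>r. real (branch_dist f l (emb (Gen_s, True) c r)) + 1"
          and l = "(c, Gen_s, True) # l" and c = 0, OF branch_dist_branch] by (auto simp: t_def)
    obtain u where u: "g u + real (nu (emb (Gen_s, True) c r - (u, 0))) \<le> branch_dist f l (emb (Gen_s, True) c r)"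
      using Suc.prems(2) by blast
    have "emb (Gen_s, True) c r - (u, 0) = emb (Gen_s, True) (c - u) r" by simp
    then obtain h where h: "real_of_int \<bar>c - u - int L * h\<bar> + M (r + h) + M h
        \<le> nu (emb (Gen_s, True) c r - (u, 0))"
      using nu_line[of Gen_s "c - u" r] by metis
    have "(1 - t / 2) * real (M (c - u)) + t / 2 * real (M (c + int L * ?m - u))
        \<le> real_of_int \<bar>c - u - int L * h\<bar> + M (r + h) + M h + (1 - t) * real (M r) + t * real (M (?m - r)) + 4"
    proof (rule affine_aux[OF t])
      show "real (M (c - u)) \<le> real_of_int \<bar>c - u - int L * h\<bar> + 2 * real (M h) + 4"
        by (rule M_le_L_real)
      show "real (M (c + int L * ?m - u)) \<le> real_of_int \<bar>c - u - int L * h\<bar> + 2 * real (M (?m + h)) + 4"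
        using M_le_L_real[of "c + int L * ?m - u" "?m + h"] by (simp add: algebra_simps)
      show "real (M h) \<le> M (r + h) + real (M r)" using M_diff_le[of "r + h" r] by simp
      show "real (M (?m + h)) \<le> M (r + h) + real (M (?m - r))"
        using M_add_le[of "r + h" "?m - r"] by (simp add: add.commute)
    qed
    then have "g u + (1 - t / 2) * M (u - c) + t / 2 * M (c + int L * ?m - u) - 4 * (1 + real k)
        \<le> branch_dist_state f (geodesic_point k 0 j ((c, Gen_s, True) # l))"
      using r u h M_minus[of "c - u"] by (simp add: del: emb.simps)
    then show ?thesis using True by (intro exI[of _ u]) (simp add: t_def field_simps)
  next
    case False
    define i where "i = j - 2 ^ k"
    then have i: "i < 2 ^ k" "j = 2 ^ k + i" using False Suc.prems(1) by auto
    \<comment> \<open>Measured from the far end, the second half mirrors the first, so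
      \<open>affine_aux\<close> applies with the two end points exchanged.\<close>
    define t :: real where "t = 1 - i / 2 ^ k"
    have t: "0 \<le> t" "t \<le> 1" using i(1) by (simp_all add: t_def)
    let ?c = "c + int L * ?m"
    obtain r where "real (branch_dist f l (emb (Gen_t, True) ?c r)) + 1 + t * M (r - - ?m)
          + (1 - t) * M (- ?m + ?m - r) - 4 * real k
        \<le> branch_dist_state f (geodesic_point k (- ?m) i ((?c, Gen_t, True) # l))"
      using Suc.IH[OF i(1), where g = "\<lambda>r. real (branch_dist f l (emb (Gen_t, True) ?c r)) + 1"
          and l = "(?c, Gen_t, True) # l" and c = "- ?m", OF branch_dist_branch] by (auto simp: t_def)
    then have r: "real (branch_dist f l (emb (Gen_t, True) ?c r)) + 1 + t * M (r + ?m) + (1 - t) * M r - 4 * real k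
        \<le> branch_dist_state f (geodesic_point k (- ?m) i ((?c, Gen_t, True) # l))"
      using M_minus[of r] by simp
    obtain u where u: "g u + real (nu (emb (Gen_t, True) ?c r - (u, 0))) \<le> branch_dist f l (emb (Gen_t, True) ?c r)"
      using Suc.prems(2) by blast
    have "emb (Gen_t, True) ?c r - (u, 0) = emb (Gen_t, True) (?c - u) r"
      by (simp add: algebra_simps)
    then obtain h where h: "real_of_int \<bar>?c - u - int L * h\<bar> + M (r + h) + M h
        \<le> nu (emb (Gen_t, True) ?c r - (u, 0))"
      using nu_line[of Gen_t "?c - u" r] by metis
    have "(1 - t / 2) * real (M (?c - u)) + t / 2 * real (M (c - u))
        \<le> real_of_int \<bar>?c - u - int L * h\<bar> + M (r + h) + M h + (1 - t) * real (M r) + t * real (M (r + ?m)) + 4"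
    proof (rule affine_aux[OF t])
      show "real (M (?c - u)) \<le> real_of_int \<bar>?c - u - int L * h\<bar> + 2 * real (M h) + 4"
        by (rule M_le_L_real)
      show "real (M (c - u)) \<le> real_of_int \<bar>?c - u - int L * h\<bar> + 2 * real (M (h - ?m)) + 4"
        using M_le_L_real[of "c - u" "h - ?m"] by (simp add: algebra_simps)
      show "real (M h) \<le> M (r + h) + real (M r)" using M_diff_le[of "r + h" r] by simp
      show "real (M (h - ?m)) \<le> M (r + h) + real (M (r + ?m))"
        using M_diff_le[of "r + h" "r + ?m"] by simp
    qed
    then have "g u + t / 2 * M (u - c) + (1 - t / 2) * M (?c - u) - 4 * (1 + real k)
        \<le> branch_dist_state f (geodesic_point k (- ?m) i ((?c, Gen_t, True) # l))"
      using r u h M_minus[of "c - u"] by (simp add: del: emb.simps)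
    moreover have "t / 2 = 1 - j / 2 ^ Suc k" "1 - t / 2 = j / 2 ^ Suc k"
      by (simp_all add: t_def i(2) field_simps)
    ultimately show ?thesis using False by (intro exI[of _ u]) (simp add: i_def)
  qed
qed

lemma last_geodesic_point: "l \<noteq> [] \<Longrightarrow> fst (geodesic_point k c j l) \<noteq> [] \<and> last (fst (geodesic_point k c j l)) = last l"
  by (induction k arbitrary: c j l) auto

text \<open>
  Here \<open>p\<close> and \<open>q\<close> lie on opposite sides of the parallelogram spanned by \<open>x\<^sup>m\<close> and \<open>y\<^sup>m\<close>, \<open>m = L\<^sup>k\<close>.
\<close>

lemma antipodal:
  assumes e: "e = Gen_s \<or> e = Gen_t" and j: "i + j + 1 = 2 ^ k"
    and pq: "p = geodesic_point k 0 i [(0, e, True)]" "q = geodesic_point k (- (int L ^ k)) j [(int L ^ Suc k, e, True)]"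
    and w: "act w p = q \<or> act w q = p"
  shows "10 * 2 ^ k - 13 - 8 * real k \<le> word_cost w"
proof -
  let ?m = "int L ^ k"
  let ?p = "geodesic_point k 0 i [(0, e, True)]" and ?q = "geodesic_point k (- ?m) j [(int L ^ Suc k, e, True)]"
  \<comment> \<open>The two sides hang on different parallel lines, so every path between them
    passes the root coset at some \<open>\<alpha>\<close>.\<close>
  have "int L ^ Suc k \<noteq> 0" using L6 by simp
  then have "fst p \<noteq> []" "fst q \<noteq> []" "last (fst p) \<noteq> last (fst q)"
    using last_geodesic_point[of "[(0, e, True)]" k 0 i] last_geodesic_point[of "[(int L ^ Suc k, e, True)]" k "- ?m" j]
    by (auto simp: pq)
  then obtain \<alpha> where \<alpha>: "branch_dist_state (dist_to \<alpha>) ?p + branch_dist_state (dist_to \<alpha>) ?q \<le> word_cost w"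
    using w word_cost_ge_through_root[of p w] word_cost_ge_through_root[of q w]
    by (metis add.commute pq)
  have ij: "i < 2 ^ k" "j < 2 ^ k" using j by auto
  define t :: real where "t = i / 2 ^ k"
  \<comment> \<open>The positions of antipodal points are complementary only up to one
    \<open>a\<close>-edge.\<close>
  define \<epsilon> :: real where "\<epsilon> = 1 / 2 ^ k"
  have "real i + real j + 1 = 2 ^ k" using arg_cong[OF j, of real] by simp
  then have tj: "t + j / 2 ^ k + \<epsilon> = 1" by (simp add: t_def \<epsilon>_def field_simps)
  have "0 \<le> t" "0 \<le> \<epsilon>" "0 \<le> j / 2 ^ k" by (simp_all add: t_def \<epsilon>_def)
  then have t: "0 \<le> t" "0 \<le> \<epsilon>" "t + \<epsilon> \<le> 1" "j / 2 ^ k = 1 - t - \<epsilon>"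
    using tj by linarith+
  obtain r where "real (branch_dist (dist_to \<alpha>) [] (emb (e, True) 0 r)) + 1 + (1 - t) * M (r - 0)
      + t * M (0 + ?m - r) - 4 * real k \<le> branch_dist_state (dist_to \<alpha>) ?p"
    using branch_dist_geodesic_point[OF ij(1), where g = "\<lambda>r. real (branch_dist (dist_to \<alpha>) [] (emb (e, True) 0 r)) + 1"
        and l = "[(0, e, True)]" and c = 0, OF branch_dist_branch] unfolding t_def by blast
  then have r: "real (nu (emb (e, True) 0 r - \<alpha>)) + (1 - t) * M r + t * M (?m - r) - 4 * real k
      \<le> branch_dist_state (dist_to \<alpha>) ?p"
    by (simp del: emb.simps)
  obtain r' where "real (branch_dist (dist_to \<alpha>) [] (emb (e, True) (int L ^ Suc k) r')) + 1
      + (1 - j / 2 ^ k) * M (r' - - ?m) + j / 2 ^ k * M (- ?m + ?m - r') - 4 * real k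
      \<le> branch_dist_state (dist_to \<alpha>) ?q"
    using branch_dist_geodesic_point[OF ij(2), where g = "\<lambda>r. real (branch_dist (dist_to \<alpha>) [] (emb (e, True) (int L ^ Suc k) r)) + 1"
        and l = "[(int L ^ Suc k, e, True)]" and c = "- ?m", OF branch_dist_branch] by blast
  then have r': "real (nu (emb (e, True) (int L ^ Suc k) r' - \<alpha>)) + (t + \<epsilon>) * M (r' + ?m)
      + (1 - t - \<epsilon>) * M r' - 4 * real k \<le> branch_dist_state (dist_to \<alpha>) ?q"
    unfolding t(4) using M_minus[of r'] by (simp del: emb.simps add: algebra_simps)
  have "nu (emb (e, True) (int L ^ Suc k) (r' - r))
      \<le> nu (emb (e, True) (int L ^ Suc k) r' - \<alpha>) + nu (\<alpha> - emb (e, True) 0 r)"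
    using nu_diff_le[of "emb (e, True) (int L ^ Suc k) r'" "emb (e, True) 0 r" \<alpha>]
    by (simp add: emb_diff del: emb.simps)
  moreover obtain h where "real_of_int \<bar>int L ^ Suc k - int L * h\<bar> + M (r' - r + h) + M h
      \<le> nu (emb (e, True) (int L ^ Suc k) (r' - r))"
    using nu_line[OF e] by blast
  moreover have "int L ^ Suc k - int L * h = int L * (?m - h)" by (simp add: algebra_simps)
  \<comment> \<open>Two copies of \<open>\<bar>?m - h\<bar>\<close> are needed: one turns
    \<open>M h\<close> into \<open>M ?m\<close>, the other replaces \<open>r' - r + h\<close> by
    \<open>r' + ?m - r\<close>.\<close>
  then have "\<bar>?m - h\<bar> + \<bar>?m - h\<bar> \<le> \<bar>int L ^ Suc k - int L * h\<bar>"
    using abs_le_L_abs[of "?m - h"] abs_ge_zero[of "?m - h"] by presburger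
  then have "real_of_int \<bar>?m - h\<bar> + real_of_int \<bar>?m - h\<bar> \<le> real_of_int \<bar>int L ^ Suc k - int L * h\<bar>"
    by linarith
  moreover have "M ?m \<le> real_of_int \<bar>?m - h\<bar> + M h"
    using M_add_le[of "?m - h" h] M_le_abs[of "?m - h"] by (simp del: of_int_abs)
  moreover have "M (r' + ?m - r) \<le> real_of_int \<bar>?m - h\<bar> + M (r' - r + h)"
    using M_add_le[of "?m - h" "r' - r + h"] M_le_abs[of "?m - h"]
    by (simp add: algebra_simps del: of_int_abs)
  ultimately have 1: "real (M ?m) + M (r' + ?m - r)
      \<le> nu (emb (e, True) (int L ^ Suc k) r' - \<alpha>) + nu (emb (e, True) 0 r - \<alpha>)"
    unfolding nu_diff_commute[of \<alpha>] by linarith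
  have "(1 - \<epsilon>) * (real (M r) + real (M (?m - r))) \<le> real (M (r' + ?m - r)) + (1 - t) * M r
      + t * M (?m - r) + (t + \<epsilon>) * M (r' + ?m) + (1 - t - \<epsilon>) * M r'"
  proof (rule affine_aux_antipodal[OF t(1,2,3)])
    show "real (M r) \<le> M (r' + ?m - r) + real (M (r' + ?m))"
      using M_diff_le[of "r' + ?m" "r' + ?m - r"] by simp
    show "real (M (?m - r)) \<le> M (r' + ?m - r) + real (M r')"
      using M_diff_le[of "r' + ?m - r" r'] by simp
  qed simp
  moreover have "(1 - \<epsilon>) * real (M ?m) \<le> (1 - \<epsilon>) * (real (M r) + real (M (?m - r)))"
    using M_add_le[of r "?m - r"] t by (intro mult_left_mono) auto
  moreover have "(1 - \<epsilon>) * (5 * 2 ^ k - 4) \<le> (1 - \<epsilon>) * real (M ?m)"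
    using M_power_L_ge_real[of k] t by (intro mult_left_mono) simp_all
  \<comment> \<open>The mismatch \<open>\<epsilon>\<close> of one edge in \<open>2 ^ k\<close> costs
    at most five letters.\<close>
  moreover have "5 * 2 ^ k - 4 - 5 \<le> (1 - \<epsilon>) * (5 * 2 ^ k - 4)"
    by (simp add: \<epsilon>_def field_simps)
  moreover have "5 * 2 ^ k - 4 \<le> real (M ?m)" by (rule M_power_L_ge_real)
  moreover have "real (branch_dist_state (dist_to \<alpha>) ?p) + branch_dist_state (dist_to \<alpha>) ?q \<le> word_cost w"
    using \<alpha> by linarith
  ultimately show ?thesis using 1 r r' by linarith
qed

section \<open>Snowflake words and the vertices they pass\<close>

definition comb :: "snowflake_gen \<Rightarrow> snowflake_gen \<Rightarrow> snowflake_gen word \<Rightarrow> snowflake_gen word" where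
  "comb c c' w = [(c, True)] @ w @ [(c, False), (c', True)] @ w @ [(c', False)]"

fun geodesic_word :: "nat \<Rightarrow> snowflake_gen word" where
  "geodesic_word 0 = [(Gen_a, True)]"
| "geodesic_word (Suc k) = comb Gen_s Gen_t (geodesic_word k)"

text \<open>
  The position of the \<open>j\<close>-th \<open>a\<close>-edge in the word, which is \<open>5j\<close> up to an error of at most \<open>k\<close>.
\<close>

fun edge_pos :: "nat \<Rightarrow> nat \<Rightarrow> nat" where
  "edge_pos 0 j = 0"
| "edge_pos (Suc k) j = (if j < 2 ^ k then Suc (edge_pos k j) else length (geodesic_word k) + 3 + edge_pos k (j - 2 ^ k))"

lemma length_comb: "length (comb c c' w) = 2 * length w + 4"
  by (simp add: comb_def)

lemma length_geodesic_word: "length (geodesic_word k) + 4 = 5 * 2 ^ k"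
  by (induction k) (auto simp: length_comb)

lemma edge_pos_le: "j < 2 ^ k \<Longrightarrow> edge_pos k j \<le> length (geodesic_word k)"
proof (induction k arbitrary: j)
  case (Suc k)
  show ?case
  proof (cases "j < 2 ^ k")
    case True
    then show ?thesis using Suc.IH[of j] by (simp add: length_comb)
  next
    case False
    then have "j - 2 ^ k < 2 ^ k" using Suc.prems by simp
    then show ?thesis using Suc.IH[of "j - 2 ^ k"] False by (simp add: length_comb)
  qed
qed simp

text \<open>Each level adds 1 in the first half, and \<open>5 * 2 ^ k - 1\<close> instead of
  \<open>5 * 2 ^ k\<close> in the second, so it contributes an error of at most 1.\<close>

lemma edge_pos_error: "j < 2 ^ k \<Longrightarrow> \<bar>int (edge_pos k j) - 5 * int j\<bar> \<le> int k"
proof (induction k arbitrary: j)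
  case (Suc k)
  show ?case
  proof (cases "j < 2 ^ k")
    case True
    then show ?thesis using Suc.IH[of j] by simp
  next
    case False
    then have "j - 2 ^ k < 2 ^ k" "int (j - 2 ^ k) = int j - 2 ^ k" using Suc.prems by auto
    moreover have "int (length (geodesic_word k)) = 5 * 2 ^ k - 4" using arg_cong[OF length_geodesic_word[of k], of int] by simp
    ultimately show ?thesis using Suc.IH[of "j - 2 ^ k"] False by simp
  qed
qed simp

text \<open>With only positive stable letters in the list, a positive crossing can never
  cancel.\<close>

definition up :: "syllable list \<Rightarrow> bool" where
  "up l \<longleftrightarrow> (\<forall>\<sigma>\<in>set l. snd (snd \<sigma>))"

lemma up_Cons [simp]: "up ((i, e, b) # l) \<longleftrightarrow> b \<and> up l"
  by (auto simp: up_def)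

lemma up_hd: "up l \<Longrightarrow> \<not> (l \<noteq> [] \<and> snd (hd l) = opp (c, True))"
  by (cases l) (auto simp: up_def)

lemma act_open:
  assumes "c = Gen_s \<or> c = Gen_t" "up l"
  shows "act [(c, True)] (l, (i, 0)) = ((i, c, True) # l, (0, 0))"
  using assms up_hd[OF assms(2), of c] by (auto simp: act_Cons cross_def)

lemma act_close:
  assumes "c = Gen_s \<or> c = Gen_t"
  shows "act [(c, False)] ((i, c, True) # l, (r, 0)) = (l, emb (c, True) i r)"
  using assms by (auto simp: act_Cons cross_def)

text \<open>By \<open>x^r = a^(L r) y^(-r)\<close>, and the same with \<open>x\<close> and
  \<open>y\<close> exchanged, the end of one block is a point of the next line, with exponent
  \<open>- r\<close> there.\<close>

lemma act_switch:
  assumes "{c, c'} = {Gen_s, Gen_t}" "up l"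
  shows "act [(c, False), (c', True)] ((i, c, True) # l, (r, 0)) = ((i + int L * r, c', True) # l, (- r, 0))"
proof -
  have c: "c = Gen_s \<and> c' = Gen_t \<or> c = Gen_t \<and> c' = Gen_s" using assms(1) by (auto simp: doubleton_eq_iff)
  have "act [(c, False), (c', True)] ((i, c, True) # l, (r, 0)) = act [(c', True)] (l, emb (c, True) i r)"
    using c act_close[of c i l r] by (metis act_Cons act_Nil)
  also have "\<dots> = ((i + int L * r, c', True) # l, (- r, 0))"
    using c up_hd[OF assms(2), of c'] by (auto simp: act_Cons cross_def)
  finally show ?thesis .
qed

lemma act_comb:
  assumes c: "{c, c'} = {Gen_s, Gen_t}" and l: "up l"
    and w: "\<And>l i. up l \<Longrightarrow> act w (l, (i, 0)) = (l, (i + m, 0))"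
  shows "act (comb c c' w) (l, (i, 0)) = (l, (i + int L * m, 0))"
proof -
  have c': "c = Gen_s \<or> c = Gen_t" "c' = Gen_s \<or> c' = Gen_t" using c by (auto simp: doubleton_eq_iff)
  show ?thesis
    using act_close[OF c'(2), of "i + int L * m" l 0] c'(2)
    by (auto simp: comb_def act_append act_open[OF c'(1) l] act_switch[OF c l] w l
        simp del: append.simps)
qed

lemma act_geodesic_word: "up l \<Longrightarrow> act (geodesic_word k) (l, (i, 0)) = (l, (i + int L ^ k, 0))"
proof (induction k arbitrary: l i)
  case (Suc k)
  then show ?case using act_comb[of Gen_s Gen_t l "geodesic_word k" "int L ^ k" i] by simp
qed (simp add: act_Cons)

text \<open>The claim about \<open>geodesic_word k\<close> is a hypothesis, so that the lemma serves
  both its inductive step and the combs in either order of \<open>s\<close> and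
  \<open>t\<close>.\<close>

lemma act_take_comb:
  assumes c: "{c, c'} = {Gen_s, Gen_t}" and l: "up l" and j: "j < 2 ^ Suc k"
    and IH: "\<And>l i j. up l \<Longrightarrow> j < 2 ^ k \<Longrightarrow> act (take (edge_pos k j) (geodesic_word k)) (l, (i, 0)) = geodesic_point k i j l"
  shows "act (take (edge_pos (Suc k) j) (comb c c' (geodesic_word k))) (l, (i, 0)) =
    (if j < 2 ^ k then geodesic_point k 0 j ((i, c, True) # l)
     else geodesic_point k (- (int L ^ k)) (j - 2 ^ k) ((i + int L ^ Suc k, c', True) # l))"
proof -
  have c': "c = Gen_s \<or> c = Gen_t" "c' = Gen_s \<or> c' = Gen_t" using c by (auto simp: doubleton_eq_iff)
  show ?thesis
  proof (cases "j < 2 ^ k")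
    case True
    have "take (edge_pos (Suc k) j) (comb c c' (geodesic_word k)) = [(c, True)] @ take (edge_pos k j) (geodesic_word k)"
      using True edge_pos_le[OF True] by (simp add: comb_def)
    then show ?thesis
      using True l by (simp only: act_append act_open[OF c'(1) l]) (simp add: IH)
  next
    case False
    then have j': "j - 2 ^ k < 2 ^ k" using j by simp
    have "take (edge_pos (Suc k) j) (comb c c' (geodesic_word k))
        = [(c, True)] @ geodesic_word k @ [(c, False), (c', True)] @ take (edge_pos k (j - 2 ^ k)) (geodesic_word k)"
      using False edge_pos_le[OF j'] by (simp add: comb_def numeral_3_eq_3)
    then show ?thesis
      using False l j'
      by (simp only: act_append act_open[OF c'(1) l]) (simp add: act_geodesic_word act_switch[OF c l] IH)
  qed
qed

lemma act_take_geodesic_word: "up l \<Longrightarrow> j < 2 ^ k \<Longrightarrow> act (take (edge_pos k j) (geodesic_word k)) (l, (i, 0)) = geodesic_point k i j l"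
proof (induction k arbitrary: l i j)
  case (Suc k)
  show ?case
    using act_take_comb[of Gen_s Gen_t l j k i] Suc by simp
qed simp

lemma act_take_comb_geodesic:
  assumes "{c, c'} = {Gen_s, Gen_t}" "up l" "j < 2 ^ Suc k"
  shows "act (take (edge_pos (Suc k) j) (comb c c' (geodesic_word k))) (l, (i, 0)) =
    (if j < 2 ^ k then geodesic_point k 0 j ((i, c, True) # l)
     else geodesic_point k (- (int L ^ k)) (j - 2 ^ k) ((i + int L ^ Suc k, c', True) # l))"
  using assms act_take_geodesic_word by (rule act_take_comb)

lemma antipodal_comb:
  assumes j: "i + j + 1 = 2 ^ Suc k"
    and w: "pres_eq (snowflake_relations L) (take (edge_pos (Suc k) i) (comb Gen_s Gen_t (geodesic_word k)) @ w)
      (take (edge_pos (Suc k) j) (comb Gen_t Gen_s (geodesic_word k)))"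
  shows "10 * 2 ^ k - 13 - 8 * real k \<le> word_cost w"
proof -
  have red: "reduced (fst (([], 0) :: state))" by simp
  have up: "up []" by (simp add: up_def)
  let ?m = "int L ^ k"
  have st: "{Gen_s, Gen_t} = {Gen_s, Gen_t}" "{Gen_t, Gen_s} = {Gen_s, Gen_t}" by auto
  define p where "p = act (take (edge_pos (Suc k) i) (comb Gen_s Gen_t (geodesic_word k))) ([], (0, 0))"
  define q where "q = act (take (edge_pos (Suc k) j) (comb Gen_t Gen_s (geodesic_word k))) ([], (0, 0))"
  have w: "act w p = q"
    using act_pres_eq[OF w, of "([], (0, 0))"] by (simp add: p_def q_def act_append)
  have ij: "i < 2 ^ Suc k" "j < 2 ^ Suc k" using j by auto
  note p = p_def[unfolded act_take_comb_geodesic[OF st(1) up ij(1)] add_0]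
  note q = q_def[unfolded act_take_comb_geodesic[OF st(2) up ij(2)] add_0]
  show ?thesis
  proof (cases "i < 2 ^ k")
    case True
    then have j': "\<not> j < 2 ^ k" "i + (j - 2 ^ k) + 1 = 2 ^ k" using j by auto
    show ?thesis
      by (rule antipodal[OF _ j'(2) p[unfolded if_P[OF True]] q[unfolded if_not_P[OF j'(1)]]])
         (simp_all add: w)
  next
    case False
    then have j': "j < 2 ^ k" "j + (i - 2 ^ k) + 1 = 2 ^ k" using j by auto
    \<comment> \<open>Now the two points lie on parallel \<open>y\<close>-lines and the one on the
      second word comes first, so \<open>p\<close> and \<open>q\<close> trade places.\<close>
    show ?thesis
      by (rule antipodal[OF _ j'(2) q[unfolded if_P[OF j'(1)]] p[unfolded if_not_P[OF False]]])
         (simp_all add: w)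
  qed
qed

end


section \<open>Distances in the graph and the loop\<close>

text \<open>A vertex function changing by at most the length of each arc extends to a 1-Lipschitz
  function on the graph: on an edge, take the cheaper way in from its two ends.\<close>

lemma pl_path_potential:
  fixes \<phi> :: "'v \<Rightarrow> real"
  assumes "pl_path G l (Vertex u) (Vertex v) r"
    and \<phi>: "\<And>e. e \<in> arcs G \<Longrightarrow> \<bar>\<phi> (head G e) - \<phi> (tail G e)\<bar> \<le> l e"
  shows "\<phi> v \<le> \<phi> u + r"
proof -
  define f where "f x = (case x of Vertex w \<Rightarrow> \<phi> w
    | Inner e t \<Rightarrow> min (\<phi> (tail G e) + t) (\<phi> (head G e) + l e - t))" for x
  have f: "f (edge_point G l e t) = min (\<phi> (tail G e) + t) (\<phi> (head G e) + l e - t)"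
    if "e \<in> arcs G" "t \<in> {0..l e}" for e t
    using that \<phi>[of e] by (auto simp: edge_point_def f_def)
  have "f (edge_point G l e t') \<le> f (edge_point G l e t) + \<bar>t - t'\<bar>"
    if "e \<in> arcs G" "t \<in> {0..l e}" "t' \<in> {0..l e}" for e t t'
    unfolding f[OF that(1,2)] f[OF that(1,3)] by linarith
  then have "f (Vertex v) \<le> f (Vertex u) + r"
    by (rule pl_path_Lipschitz[OF assms(1)])
  then show ?thesis by (simp add: f_def)
qed

lemma graph_dist_le:
  assumes "p \<in> graph_points G l" "q \<in> graph_points G l" "pl_path G l p q r"
  shows "graph_dist G l p q \<le> r"
  using assms unfolding graph_dist_def
  by (auto intro!: cInf_lower bdd_belowI[of _ 0] dest: pl_path_nonneg)

lemma graph_dist_ge: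
  assumes "p \<in> graph_points G l" "q \<in> graph_points G l" "pl_path G l p q r0"
    and "\<And>r. pl_path G l p q r \<Longrightarrow> c \<le> r"
  shows "c \<le> graph_dist G l p q"
  using assms unfolding graph_dist_def by (auto intro!: cInf_greatest)

context snowflake
begin

abbreviation cls :: "snowflake_gen word \<Rightarrow> snowflake_gen word set" where
  "cls \<equiv> pres_class (snowflake_relations L)"

abbreviation X :: "snowflake_point metric" where
  "X \<equiv> snowflake_graph L"

abbreviation vx :: "snowflake_gen word \<Rightarrow> snowflake_point" where
  "vx w \<equiv> Vertex (cls w)"

abbreviation G where
  "G \<equiv> cayley_graph (snowflake_group L) (snowflake_elem L)"

lemma word_inv_word_inv: "word_inv (word_inv w) = w"
  by (simp add: word_inv_def rev_map comp_def case_prod_unfold)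

lemma cls_append_cong: "cls u = cls u' \<Longrightarrow> cls v = cls v' \<Longrightarrow> cls (u @ v) = cls (u' @ v')"
  by (simp add: pres_class_eq_iff pres_eq.append)

lemma cls_cancel: "cls (u @ [(c, b), (c, \<not> b)]) = cls u"
  using pres_eq.append[OF pres_eq.refl[of _ u] pres_eq.cancel[of _ c b]]
  by (simp add: pres_class_eq_iff)

lemma snowflake_graph_simps:
  "verts G = range cls" "arcs G = range cls \<times> UNIV" "tail G (g, c) = g"
  "head G (cls u, c) = cls (u @ [(c, True)])"
  by (simp_all add: cayley_graph_def snowflake_group_def snowflake_elem_def
      carrier_presented_group mult_presented_group)

lemma wf_snowflake: "wf_digraph G"
  by unfold_locales (auto simp: snowflake_graph_simps)

lemma vx_in [simp]: "vx w \<in> mspace X" "vx w \<in> graph_points G (snowflake_length L)"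
  using L6 by (auto simp: mspace_snowflake_graph graph_points_def snowflake_graph_simps)

lemma mdist_X: "mdist X = graph_dist G (snowflake_length L)"
  using L6 by (intro mdist_snowflake_graph) simp

lemma snowflake_length_eq: "snowflake_length L (g, c) = letter_cost (c, b)"
  by (simp add: snowflake_length_def)

lemma pl_path_word: "pl_path G (snowflake_length L) (vx u) (vx (u @ w)) (word_cost w)"
proof (induction w rule: rev_induct)
  case Nil
  show ?case by (simp add: pl_path.const)
next
  case (snoc g w)
  let ?l = "snowflake_length L"
  obtain c b where g: "g = (c, b)" by (cases g)
  have edge: "pl_path G ?l (vx v) (vx (v @ [(c, True)])) (letter_cost (c, b))" for v
  proof -
    have "?l (cls v, c) > 0" using L6 by (simp add: snowflake_length_def)
    then have "pl_path G ?l (vx v) (vx (v @ [(c, True)])) (?l (cls v, c))"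
      using pl_path_segment[OF wf_snowflake, of "(cls v, c)" 0 ?l "?l (cls v, c)"]
      by (auto simp: edge_point_def snowflake_graph_simps)
    then show ?thesis by (simp add: snowflake_length_eq[of _ c b])
  qed
  have "pl_path G ?l (vx (u @ w)) (vx ((u @ w) @ [g])) (letter_cost g)"
  proof (cases b)
    case True
    then show ?thesis using edge[of "u @ w"] by (simp add: g)
  next
    case False
    have "cls ((u @ w @ [(c, False)]) @ [(c, True)]) = cls (u @ w)"
      using cls_cancel[of "u @ w" c False] by simp
    then show ?thesis
      using pl_path_rev[OF wf_snowflake edge[of "u @ w @ [(c, False)]"]] False by (simp add: g)
  qed
  then show ?case using pl_path_append[OF snoc] by simp
qed

lemma mdist_le_word_cost: "mdist X (vx u) (vx (u @ w)) \<le> word_cost w"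
  unfolding mdist_X by (rule graph_dist_le[OF _ _ pl_path_word]) simp_all

text \<open>The least cost \<open>\<phi>\<close> of a word leading from \<open>u\<close> to a vertex
  is such a potential, so piecewise linear paths are no shorter than words.\<close>

lemma mdist_ge:
  assumes "\<And>w. pres_eq (snowflake_relations L) (u @ w) v \<Longrightarrow> c \<le> real (word_cost w)"
  shows "c \<le> mdist X (vx u) (vx v)"
proof -
  define \<phi> where "\<phi> g = (LEAST n. \<exists>w. cls (u @ w) = g \<and> word_cost w = n)" for g
  have "cls (u @ word_inv u @ w) = cls w" for w
    using cls_append_cong[of "u @ word_inv u" "[]" w w] word_inv_left[of _ "word_inv u"]
    by (simp add: pres_class_eq_iff word_inv_word_inv)
  then have ex: "\<exists>n w. cls (u @ w) = cls v \<and> word_cost w = n" for v by blast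
  have att: "\<exists>w. cls (u @ w) = cls v \<and> word_cost w = \<phi> (cls v)" for v
    unfolding \<phi>_def by (rule LeastI_ex[OF ex])
  have le: "\<phi> (cls (u @ w)) \<le> word_cost w" for w
    unfolding \<phi>_def by (rule Least_le) blast
  have step: "\<phi> (cls (v @ [(c, b)])) \<le> \<phi> (cls v) + letter_cost (c, b)" for v c b
  proof -
    obtain w where w: "cls (u @ w) = cls v" "word_cost w = \<phi> (cls v)" using att by blast
    have "cls (u @ (w @ [(c, b)])) = cls (v @ [(c, b)])"
      using cls_append_cong[OF w(1) HOL.refl, of "[(c, b)]"] by simp
    then show ?thesis using le[of "w @ [(c, b)]"] w(2) by (simp del: letter_cost.simps)
  qed
  have lip: "\<bar>real (\<phi> (head G e)) - real (\<phi> (tail G e))\<bar> \<le> snowflake_length L e" if "e \<in> arcs G" for e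
  proof -
    have "fst e \<in> range cls" using that by (simp add: snowflake_graph_simps mem_Times_iff)
    then obtain v c where e: "e = (cls v, c)" by (metis imageE prod.collapse)
    have "cls ((v @ [(c, True)]) @ [(c, False)]) = cls v" using cls_cancel[of v c True] by simp
    then show ?thesis
      using step[of v c True] step[of "v @ [(c, True)]" c False]
      by (simp add: e snowflake_graph_simps snowflake_length_eq[of _ c True] del: letter_cost.simps)
        (simp add: abs_le_iff)
  qed
  have "\<phi> (cls u) = 0" using le[of "[]"] by simp
  obtain w where w: "cls (u @ w) = cls v" "word_cost w = \<phi> (cls v)" using att by blast
  show ?thesis unfolding mdist_X
  proof (rule graph_dist_ge)
    show "pl_path G (snowflake_length L) (vx u) (vx v) (word_cost w)"
      using pl_path_word[of u w] w(1) by simp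
    fix r assume "pl_path G (snowflake_length L) (vx u) (vx v) r"
    then have "real (\<phi> (cls v)) \<le> real (\<phi> (cls u)) + r"
      by (rule pl_path_potential) (rule lip)
    moreover have "c \<le> word_cost w" using assms w(1) by (simp add: pres_class_eq_iff)
    ultimately show "c \<le> r" using \<open>\<phi> (cls u) = 0\<close> w(2) by simp
  qed simp_all
qed

lemma word_cost_eq_length:
  "Gen_x \<notin> fst ` set w \<Longrightarrow> Gen_y \<notin> fst ` set w \<Longrightarrow> word_cost w = length w"
  by (induction w) auto

lemma mdist_prefixes:
  assumes "Gen_x \<notin> fst ` set w" "Gen_y \<notin> fst ` set w"
  shows "mdist X (vx (take i w)) (vx (take j w)) \<le> \<bar>real i - real j\<bar>"
proof -
  have *: "mdist X (vx (take i w)) (vx (take j w)) \<le> real j - real i" if "i \<le> j" for i j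
  proof -
    let ?v = "take (j - i) (drop i w)"
    have "set ?v \<subseteq> set w" by (meson set_drop_subset set_take_subset subset_trans)
    then have "word_cost ?v = length ?v"
      using assms by (intro word_cost_eq_length) auto
    moreover have "take j w = take i w @ ?v" using take_add[of i "j - i" w] that by simp
    moreover have "length ?v \<le> j - i" by simp
    ultimately show ?thesis using mdist_le_word_cost[of "take i w" ?v] that by simp
  qed
  show ?thesis
  proof (cases "i \<le> j")
    case True
    then show ?thesis using *[of i j] by simp
  next
    case False
    then show ?thesis
      using *[of j i] by (simp add: mdist_commute[of X "vx (take i w)" "vx (take j w)"])
  qed
qed

section \<open>The loop and its almost isometric parametrisation\<close>

lemma comb_no_xy:
  assumes "{c, c'} = {Gen_s, Gen_t}"
  shows "Gen_x \<notin> fst ` set (comb c c' (geodesic_word k))" "Gen_y \<notin> fst ` set (comb c c' (geodesic_word k))"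
proof -
  have *: "fst ` set (comb c c' w) = {c, c'} \<union> fst ` set w" for w c c' by (auto simp: comb_def)
  have "fst ` set (geodesic_word k) \<subseteq> {Gen_a, Gen_s, Gen_t}" by (induction k) (auto simp: *)
  then show "Gen_x \<notin> fst ` set (comb c c' (geodesic_word k))" "Gen_y \<notin> fst ` set (comb c c' (geodesic_word k))"
    unfolding * assms by auto
qed

text \<open>\<open>geodesic_word k\<close> represents \<open>a^m\<close> with
  \<open>m = L ^ k\<close>, so the two combs represent \<open>x^m y^m\<close> and
  \<open>y^m x^m\<close>.\<close>

lemma cls_comb_geodesic:
  "cls (comb Gen_s Gen_t (geodesic_word k)) = cls (comb Gen_t Gen_s (geodesic_word k))"
proof -
  interpret H: group "snowflake_group L" by (simp add: snowflake_group_def group_presented_group)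
  let ?H = "snowflake_group L" and ?R = "snowflake_relations L"
  let ?e = "snowflake_elem L"
  have mult: "cls (u @ v) = cls u \<otimes>\<^bsub>?H\<^esub> cls v" for u v
    by (simp add: snowflake_group_def mult_presented_group)
  have one: "\<one>\<^bsub>?H\<^esub> = cls []" by (simp add: snowflake_group_def one_presented_group)
  have [simp, intro]: "cls u \<in> carrier ?H" for u
    by (simp add: snowflake_group_def carrier_presented_group)
  have el: "cls [(c, True)] = ?e c" for c by (simp add: snowflake_elem_def)
  have [simp, intro]: "?e c \<in> carrier ?H" for c by (simp add: el[symmetric])
  have inv: "cls [(c, False)] = inv\<^bsub>?H\<^esub> ?e c" for c
  proof -
    have "cls [(c, False)] \<otimes>\<^bsub>?H\<^esub> ?e c = \<one>\<^bsub>?H\<^esub>"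
      using cls_cancel[of "[]" c False] by (simp add: el[symmetric] mult[symmetric] one)
    then show ?thesis by (intro H.inv_equality[symmetric]) auto
  qed
  have rel: "cls u = cls v" if "(u, v) \<in> ?R" for u v
    using that by (simp add: pres_class_eq_iff pres_eq.relation)
  have conj: "?e c \<otimes>\<^bsub>?H\<^esub> ?e Gen_a \<otimes>\<^bsub>?H\<^esub> inv\<^bsub>?H\<^esub> ?e c = ?e d"
    if "([(c, True), (Gen_a, True), (c, False)], [(d, True)]) \<in> ?R" for c d
    using rel[OF that] mult[of "[(c, True)]" "[(Gen_a, True), (c, False)]"]
      mult[of "[(Gen_a, True)]" "[(c, False)]"] by (simp add: el inv H.m_assoc)
  have conj_pow: "?e c \<otimes>\<^bsub>?H\<^esub> ?e Gen_a [^]\<^bsub>?H\<^esub> n \<otimes>\<^bsub>?H\<^esub> inv\<^bsub>?H\<^esub> ?e c = ?e d [^]\<^bsub>?H\<^esub> n"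
    if "([(c, True), (Gen_a, True), (c, False)], [(d, True)]) \<in> ?R" for c d and n :: nat
  proof (induction n)
    case (Suc n)
    have "?e d [^]\<^bsub>?H\<^esub> Suc n = (?e c \<otimes>\<^bsub>?H\<^esub> ?e Gen_a [^]\<^bsub>?H\<^esub> n \<otimes>\<^bsub>?H\<^esub> inv\<^bsub>?H\<^esub> ?e c)
        \<otimes>\<^bsub>?H\<^esub> (?e c \<otimes>\<^bsub>?H\<^esub> ?e Gen_a \<otimes>\<^bsub>?H\<^esub> inv\<^bsub>?H\<^esub> ?e c)"
      by (simp add: Suc conj[OF that])
    also have "\<dots> = ?e c \<otimes>\<^bsub>?H\<^esub> ?e Gen_a [^]\<^bsub>?H\<^esub> Suc n \<otimes>\<^bsub>?H\<^esub> inv\<^bsub>?H\<^esub> ?e c"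
      by (simp add: H.m_assoc) (simp add: H.m_assoc[symmetric])
    finally show ?case by simp
  qed simp
  have st: "([(Gen_s, True), (Gen_a, True), (Gen_s, False)], [(Gen_x, True)]) \<in> ?R"
    "([(Gen_t, True), (Gen_a, True), (Gen_t, False)], [(Gen_y, True)]) \<in> ?R"
    by (simp_all add: snowflake_relations_def word_inv_def Let_def)
  have xy: "?e Gen_x \<otimes>\<^bsub>?H\<^esub> ?e Gen_y = ?e Gen_y \<otimes>\<^bsub>?H\<^esub> ?e Gen_x"
  proof -
    have "(word_comm [(Gen_x, True)] [(Gen_y, True)], []) \<in> ?R"
      by (simp add: snowflake_relations_def Let_def)
    from rel[OF this] have "cls ([(Gen_x, True)] @ [(Gen_y, True)] @ [(Gen_x, False)] @ [(Gen_y, False)]) = \<one>\<^bsub>?H\<^esub>"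
      by (simp add: word_comm_def word_inv_def one)
    then have "(?e Gen_x \<otimes>\<^bsub>?H\<^esub> ?e Gen_y) \<otimes>\<^bsub>?H\<^esub> inv\<^bsub>?H\<^esub> (?e Gen_y \<otimes>\<^bsub>?H\<^esub> ?e Gen_x) = \<one>\<^bsub>?H\<^esub>"
      unfolding mult el inv by (simp add: H.inv_mult_group H.m_assoc)
    then show ?thesis using H.inv_equality[of "?e Gen_x \<otimes>\<^bsub>?H\<^esub> ?e Gen_y" "inv\<^bsub>?H\<^esub> (?e Gen_y \<otimes>\<^bsub>?H\<^esub> ?e Gen_x)"]
      by simp
  qed
  have rep: "cls (replicate n (Gen_a, True)) = ?e Gen_a [^]\<^bsub>?H\<^esub> n" for n
  proof (induction n)
    case (Suc n)
    then show ?case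
      using mult[of "replicate n (Gen_a, True)" "[(Gen_a, True)]"]
      by (simp add: replicate_append_same el)
  qed (simp add: one)
  have aL: "?e Gen_a [^]\<^bsub>?H\<^esub> L = ?e Gen_x \<otimes>\<^bsub>?H\<^esub> ?e Gen_y"
  proof -
    have "(replicate L (Gen_a, True), [(Gen_x, True)] @ [(Gen_y, True)]) \<in> ?R"
      by (simp add: snowflake_relations_def Let_def concat_replicate_singleton)
    from rel[OF this] show ?thesis unfolding mult el rep .
  qed
  have comb: "cls (comb c c' w) = (?e c \<otimes>\<^bsub>?H\<^esub> cls w \<otimes>\<^bsub>?H\<^esub> inv\<^bsub>?H\<^esub> ?e c)
      \<otimes>\<^bsub>?H\<^esub> (?e c' \<otimes>\<^bsub>?H\<^esub> cls w \<otimes>\<^bsub>?H\<^esub> inv\<^bsub>?H\<^esub> ?e c')" for c c' w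
  proof -
    have "comb c c' w = [(c, True)] @ w @ [(c, False)] @ [(c', True)] @ w @ [(c', False)]"
      by (simp add: comb_def)
    then show ?thesis by (simp add: mult el inv H.m_assoc del: append.simps)
  qed
  have geodesic_word: "cls (geodesic_word k) = ?e Gen_a [^]\<^bsub>?H\<^esub> (L ^ k)"
  proof (induction k)
    case (Suc k)
    have "cls (geodesic_word (Suc k)) = ?e Gen_x [^]\<^bsub>?H\<^esub> (L ^ k) \<otimes>\<^bsub>?H\<^esub> ?e Gen_y [^]\<^bsub>?H\<^esub> (L ^ k)"
      by (simp add: comb Suc conj_pow[OF st(1)] conj_pow[OF st(2)])
    also have "\<dots> = (?e Gen_a [^]\<^bsub>?H\<^esub> L) [^]\<^bsub>?H\<^esub> (L ^ k)"
      unfolding aL by (rule H.pow_mult_distrib[OF xy, symmetric]) auto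
    finally show ?case by (simp add: H.nat_pow_pow)
  qed (simp add: el)
  have "?e Gen_x [^]\<^bsub>?H\<^esub> n \<otimes>\<^bsub>?H\<^esub> ?e Gen_y [^]\<^bsub>?H\<^esub> n = ?e Gen_y [^]\<^bsub>?H\<^esub> n \<otimes>\<^bsub>?H\<^esub> ?e Gen_x [^]\<^bsub>?H\<^esub> n" for n :: nat
    using H.pow_mult_distrib[OF xy, of n] H.pow_mult_distrib[OF xy[symmetric], of n] xy by simp
  then show ?thesis
    by (simp add: comb geodesic_word conj_pow[OF st(1)] conj_pow[OF st(2)])
qed

text \<open>
  The loop follows one half of the parallelogram from \<open>1\<close> to \<open>a\<^bsup>Lm\<^esup>\<close> and returns along the other half; it
  consists of the initial vertices of the \<open>2\<^bsup>n+2\<^esup>\<close> \<open>a\<close>-edges.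
\<close>

definition loop :: "nat \<Rightarrow> nat \<Rightarrow> snowflake_gen word" where
  "loop n i = (if i < 2 ^ Suc n then take (edge_pos (Suc n) i) (comb Gen_s Gen_t (geodesic_word n))
    else take (edge_pos (Suc n) (2 * 2 ^ Suc n - 1 - i)) (comb Gen_t Gen_s (geodesic_word n)))"

lemma loop_dist_le:
  assumes "i \<le> j" "j < 2 * 2 ^ Suc n"
  shows "mdist X (vx (loop n i)) (vx (loop n j)) \<le> 5 * (real j - real i) + 2 * n + 7"
    and "mdist X (vx (loop n i)) (vx (loop n j)) \<le> 5 * (2 * 2 ^ Suc n - (real j - real i)) + 2 * n + 7"
proof -
  define K :: nat where "K = 2 ^ Suc n"
  let ?U = "comb Gen_s Gen_t (geodesic_word n)" and ?V = "comb Gen_t Gen_s (geodesic_word n)"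
  let ?d = "mdist X (vx (loop n i)) (vx (loop n j))"
  have st: "{Gen_s, Gen_t} = {Gen_s, Gen_t}" "{Gen_t, Gen_s} = {Gen_s, Gen_t}" by auto
  have pe: "\<bar>real (edge_pos (Suc n) i) - 5 * real i\<bar> \<le> real n + 1" if "i < K" for i
    using edge_pos_error[of i "Suc n"] that unfolding K_def by linarith
  note U = mdist_prefixes[OF comb_no_xy[OF st(1), of n]]
  note V = mdist_prefixes[OF comb_no_xy[OF st(2), of n]]
  have j: "j < 2 * K" using assms by (simp add: K_def)
  have ij: "real i \<le> real j" using assms(1) by simp
  have "?d \<le> 5 * real j - 5 * real i + 2 * real n + 7 \<and>
    ?d \<le> 10 * real K - 5 * real j + 5 * real i + 2 * real n + 7"
  proof (cases "i < K")
    case i: True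
    show ?thesis
    proof (cases "j < K")
      case True
      then have "?d \<le> \<bar>real (edge_pos (Suc n) i) - real (edge_pos (Suc n) j)\<bar>"
        using U[of "edge_pos (Suc n) i" "edge_pos (Suc n) j"] i by (simp add: loop_def K_def del: edge_pos.simps)
      moreover have "real j < real K" using True by simp
      ultimately show ?thesis using pe[OF i] pe[OF True] ij of_nat_0_le_iff[of i, where 'a = real]
        by (intro conjI) linarith+
    next
      case False
      define j' where "j' = 2 * K - 1 - j"
      have j': "j' < K" "real j' = 2 * real K - 1 - real j" using False j by (auto simp: j'_def)
      have eq: "loop n i = take (edge_pos (Suc n) i) ?U" "loop n j = take (edge_pos (Suc n) j') ?V"
        using i False by (simp_all add: loop_def K_def j'_def del: edge_pos.simps)
      have len: "length ?U = 5 * K - 4" "length ?V = 5 * K - 4" and "K \<ge> 2"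
        using length_geodesic_word[of n] by (simp_all add: K_def length_comb)
      then have lenr: "real (5 * K - 4) = 5 * real K - 4" by simp
      \<comment> \<open>The two arcs joining points on different words: first through the vertex
        \<open>1\<close>, then through the common end of the words.\<close>
      have "?d \<le> mdist X (vx (loop n i)) (vx []) + mdist X (vx []) (vx (loop n j))"
        by (rule mdist_triangle) simp_all
      also have "\<dots> \<le> real (edge_pos (Suc n) i) + real (edge_pos (Suc n) j')"
        using U[of "edge_pos (Suc n) i" 0] V[of 0 "edge_pos (Suc n) j'"] by (simp add: eq del: edge_pos.simps)
      finally have 1: "?d \<le> real (edge_pos (Suc n) i) + real (edge_pos (Suc n) j')" .
      have ple: "real (edge_pos (Suc n) i) \<le> 5 * real K - 4" "real (edge_pos (Suc n) j') \<le> 5 * real K - 4"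
        unfolding lenr[symmetric]
        using edge_pos_le[of i "Suc n", folded K_def, OF i] edge_pos_le[of j' "Suc n", folded K_def, OF j'(1)] len(1)
        by (simp_all del: edge_pos.simps of_nat_diff)
      have "?d \<le> mdist X (vx (loop n i)) (vx ?U) + mdist X (vx ?V) (vx (loop n j))"
        using mdist_triangle[of "vx (loop n i)" X "vx ?U" "vx (loop n j)"] cls_comb_geodesic by simp
      also have "\<dots> \<le> (5 * real K - 4 - edge_pos (Suc n) i) + (5 * real K - 4 - edge_pos (Suc n) j')"
        using U[of "edge_pos (Suc n) i" "length ?U"] V[of "length ?V" "edge_pos (Suc n) j'"] len lenr ple
        by (simp add: eq del: edge_pos.simps)
      finally show ?thesis using 1 pe[OF i] pe[OF j'(1)] j'(2) by (intro conjI) linarith+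
    qed
  next
    case False
    define i' j' where "i' = 2 * K - 1 - i" and "j' = 2 * K - 1 - j"
    have ij': "i' < K" "real i' = 2 * real K - 1 - real i" "j' < K" "real j' = 2 * real K - 1 - real j"
      using False j assms(1) by (auto simp: i'_def j'_def)
    have "?d \<le> \<bar>real (edge_pos (Suc n) i') - real (edge_pos (Suc n) j')\<bar>"
      using V[of "edge_pos (Suc n) i'" "edge_pos (Suc n) j'"] False assms(1)
      by (simp add: loop_def K_def i'_def j'_def del: edge_pos.simps)
    moreover have "real K \<le> real i" using False by simp
    ultimately show ?thesis
      using pe[OF ij'(1)] pe[OF ij'(3)] ij'(2,4) ij of_nat_less_iff[of j "2 * K", where 'a = real] j
      by (intro conjI) (simp, linarith)+
  qed
  then show "?d \<le> 5 * (real j - real i) + 2 * n + 7"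
    and "?d \<le> 5 * (2 * 2 ^ Suc n - (real j - real i)) + 2 * n + 7"
    by (simp_all add: K_def algebra_simps)
qed

lemma loop_antipodal:
  assumes "i < 2 ^ Suc n"
  shows "5 * 2 ^ Suc n - 13 - 8 * real n \<le> mdist X (vx (loop n i)) (vx (loop n (i + 2 ^ Suc n)))"
proof -
  define j where "j = 2 ^ Suc n - 1 - i"
  have j: "i + j + 1 = 2 ^ Suc n" "2 * 2 ^ Suc n - 1 - (i + 2 ^ Suc n) = j"
    using assms by (auto simp: j_def)
  have "loop n i = take (edge_pos (Suc n) i) (comb Gen_s Gen_t (geodesic_word n))"
    "loop n (i + 2 ^ Suc n) = take (edge_pos (Suc n) j) (comb Gen_t Gen_s (geodesic_word n))"
    using assms j(2) by (simp_all add: loop_def del: edge_pos.simps power_Suc)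
  then show ?thesis
    using antipodal_comb[OF j(1)] by (intro mdist_ge) (simp del: edge_pos.simps)
qed

text \<open>The antipode of \<open>i\<close> is almost half the loop away, and \<open>j\<close> lies
  on an arc from \<open>i\<close> to it; subtracting the upper bound for the rest of this arc leaves
  the claim. The errors \<open>13 + 8 * n\<close> and \<open>7 + 2 * n\<close> add up.\<close>

lemma loop_dist_ge:
  assumes ij: "i \<le> j" "j < 2 * 2 ^ Suc n"
  shows "5 * min (real j - real i) (2 * 2 ^ Suc n - (real j - real i)) - (20 + 10 * n)
    \<le> mdist X (vx (loop n i)) (vx (loop n j))"
proof -
  define K :: nat where "K = 2 ^ Suc n"
  have K: "(2::real) ^ Suc n = real K" by (simp add: K_def)
  let ?D = "\<lambda>i j. mdist X (vx (loop n i)) (vx (loop n j))"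
  have tri: "?D i k \<le> ?D i j + ?D j k" for k by (rule mdist_triangle) simp_all
  have com: "?D i j = ?D j i" for i j by (rule mdist_commute)
  note le = loop_dist_le[where n = n, folded K_def, unfolded K]
  note anti = loop_antipodal[where n = n, folded K_def, unfolded K]
  have j: "j < 2 * K" using ij by (simp add: K_def)
  define m where "m = min (real j - real i) (2 * real K - (real j - real i))"
  have m: "5 * m \<le> 5 * real j - 5 * real i" "5 * m \<le> 10 * real K - 5 * real j + 5 * real i"
    by (simp_all add: m_def min_def)
  show ?thesis unfolding K m_def[symmetric]
  proof (cases "i < K")
    case True
    have "5 * m + ?D j (i + K) \<le> 5 * real K + 2 * real n + 7"
    proof (cases "j \<le> i + K")
      case True
      then show ?thesis using le(1)[of j "i + K"] \<open>i < K\<close> m by simp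
    next
      case False
      then show ?thesis using le(1)[of "i + K" j] j com[of j "i + K"] m by simp
    qed
    then show "5 * m - (20 + 10 * n) \<le> ?D i j"
      using anti[OF True] tri[of "i + K"] by simp
  next
    case False
    then have "i - K < K" "i - K + K = i" "real (i - K) = real i - real K"
      using ij j by auto
    moreover have "?D j (i - K) \<le> 5 * (2 * real K - (real j - real (i - K))) + 2 * n + 7"
      using le(2)[of "i - K" j] ij j com[of j "i - K"] by simp
    ultimately show "5 * m - (20 + 10 * n) \<le> ?D i j"
      using anti[of "i - K"] tri[of "i - K"] com[of i "i - K"] m by simp
  qed
qed

lemma loop_dist:
  assumes "i < 2 * 2 ^ Suc n" "j < 2 * 2 ^ Suc n"
  shows "\<bar>mdist X (vx (loop n i)) (vx (loop n j))
    - 5 * min \<bar>real i - real j\<bar> (2 * 2 ^ Suc n - \<bar>real i - real j\<bar>)\<bar> \<le> 20 + 10 * real n"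
proof -
  have *: "\<bar>mdist X (vx (loop n i)) (vx (loop n j))
      - 5 * min (real j - real i) (2 * 2 ^ Suc n - (real j - real i))\<bar> \<le> 20 + 10 * real n"
    if "i \<le> j" "j < 2 * 2 ^ Suc n" for i j
    using loop_dist_le[OF that] loop_dist_ge[OF that] by linarith
  show ?thesis
  proof (cases "i \<le> j")
    case True
    then show ?thesis using *[of i j] assms by simp
  next
    case False
    then show ?thesis
      using *[of j i] assms
      by (simp add: mdist_commute[of X "vx (loop n i)" "vx (loop n j)"] abs_minus_commute)
  qed
qed

end


section \<open>The asymptotic cone\<close>

lemma ex_nonprincipal_ultrafilter:
  obtains \<omega> :: "nat filter" where "nonprincipal_ultrafilter \<omega>" "\<omega> \<le> sequentially"
proof -
  define A where "A = {F :: nat filter. F \<noteq> bot \<and> F \<le> sequentially}"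
  \<comment> \<open>The order is reversed so that Zorn's lemma gives a minimal proper filter, which
    is an ultrafilter; staying below \<open>sequentially\<close> makes it non-principal and lets
    ordinary limits pass to it.\<close>
  define P where "P = (\<lambda>F G :: nat filter. G \<le> F)"
  have "\<exists>\<omega>\<in>A. \<forall>F\<in>A. P \<omega> F \<longrightarrow> F = \<omega>"
  proof (rule predicate_Zorn)
    show "partial_order_on A (relation_of P A)"
      by (rule partial_order_on_relation_ofI) (auto simp: P_def)
    fix C assume C: "C \<in> Chains (relation_of P A)"
    then have "C \<subseteq> A" by (rule Chains_relation_of)
    show "\<exists>u\<in>A. \<forall>F\<in>C. P F u"
    proof (cases "C = {}")
      case True
      then show ?thesis by (auto simp: A_def intro: exI[of _ sequentially])
    next
      case False
      have "\<exists>H\<in>C. H \<le> inf F G" if "F \<in> C" "G \<in> C" for F G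
        using C that unfolding Chains_def relation_of_def P_def
        by (smt (verit) case_prodD inf.absorb_iff1 inf.absorb_iff2 mem_Collect_eq order_refl)
      then have ev: "eventually Q (Inf C) \<longleftrightarrow> (\<exists>F\<in>C. eventually Q F)" for Q
        using False by (intro eventually_Inf_base) auto
      have "Inf C \<noteq> bot"
        using ev[of "\<lambda>_. False"] \<open>C \<subseteq> A\<close> by (auto simp: trivial_limit_def A_def)
      moreover have "Inf C \<le> sequentially"
        using False \<open>C \<subseteq> A\<close> by (auto simp: A_def intro: Inf_lower2)
      ultimately show ?thesis by (auto simp: A_def P_def Inf_lower intro!: bexI[of _ "Inf C"])
    qed
  qed
  then obtain \<omega> where \<omega>: "\<omega> \<noteq> bot" "\<omega> \<le> sequentially"
    and min: "\<And>F. F \<noteq> bot \<Longrightarrow> F \<le> \<omega> \<Longrightarrow> F = \<omega>"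
    unfolding A_def P_def by (auto intro: order_trans)
  have "eventually (\<lambda>i. \<not> Q i) \<omega>" if "\<not> eventually Q \<omega>" for Q
  proof -
    let ?F = "inf \<omega> (principal {i. \<not> Q i})"
    have "?F \<noteq> bot" using that by (simp add: trivial_limit_def eventually_inf_principal)
    then have "?F = \<omega>" by (intro min) simp_all
    then have "\<omega> \<le> principal {i. \<not> Q i}" by (metis inf_le2)
    then show ?thesis by (simp add: le_principal)
  qed
  moreover have "\<omega> \<noteq> principal {i}" for i
  proof
    assume "\<omega> = principal {i}"
    then have "eventually (\<lambda>n. i < n) (principal {i})"
      using \<omega>(2) eventually_gt_at_top[of i] by (auto simp: le_filter_def)
    then show False by (simp add: eventually_principal)
  qed
  ultimately show ?thesis using that \<omega> by (auto simp: nonprincipal_ultrafilter_def)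
qed

lemma floor_ratio_tendsto:
  fixes c :: "nat \<Rightarrow> real"
  assumes "0 \<le> \<theta>" "filterlim c at_top sequentially"
  shows "(\<lambda>n. real (nat \<lfloor>\<theta> * c n\<rfloor>) / c n) \<longlonglongrightarrow> \<theta>"
proof (rule tendsto_sandwich)
  have pos: "eventually (\<lambda>n. c n > 0) sequentially"
    using assms(2) by (simp add: filterlim_at_top_dense)
  have bounds: "\<theta> - 1 / c n \<le> real (nat \<lfloor>\<theta> * c n\<rfloor>) / c n"
    "real (nat \<lfloor>\<theta> * c n\<rfloor>) / c n \<le> \<theta>" if c: "c n > 0" for n
  proof -
    define x where "x = real (nat \<lfloor>\<theta> * c n\<rfloor>)"
    have "x = of_int \<lfloor>\<theta> * c n\<rfloor>" using assms(1) c by (simp add: x_def)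
    then have "\<theta> * c n - 1 \<le> x" "x \<le> \<theta> * c n" by linarith+
    then have "(\<theta> * c n - 1) / c n \<le> x / c n" "x / c n \<le> \<theta> * c n / c n"
      using c by (intro divide_right_mono; simp)+
    then show "\<theta> - 1 / c n \<le> real (nat \<lfloor>\<theta> * c n\<rfloor>) / c n"
      "real (nat \<lfloor>\<theta> * c n\<rfloor>) / c n \<le> \<theta>"
      using c unfolding x_def[symmetric] by (simp_all add: diff_divide_distrib)
  qed
  show "eventually (\<lambda>n. \<theta> - 1 / c n \<le> real (nat \<lfloor>\<theta> * c n\<rfloor>) / c n) sequentially"
    "eventually (\<lambda>n. real (nat \<lfloor>\<theta> * c n\<rfloor>) / c n \<le> \<theta>) sequentially"
    using pos by (auto elim!: eventually_mono intro: bounds)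
  have "(\<lambda>n. 1 / c n) \<longlonglongrightarrow> 0"
    using assms(2) by (rule tendsto_divide_0[OF tendsto_const filterlim_at_top_imp_at_infinity])
  then show "(\<lambda>n. \<theta> - 1 / c n) \<longlonglongrightarrow> \<theta>" by (auto intro: tendsto_eq_intros)
qed simp

context snowflake
begin

section \<open>Rescaling the loops to a circle\<close>

definition loop_point :: "real \<Rightarrow> nat \<Rightarrow> snowflake_point" where
  "loop_point \<theta> n = vx (loop n (nat \<lfloor>\<theta> * (2 * 2 ^ Suc n)\<rfloor>))"

text \<open>The loop has length \<open>10 * 2 ^ Suc n - 8\<close>, so its rescaled length tends to
  1.\<close>

definition loop_scale :: "nat \<Rightarrow> real" where
  "loop_scale n = 10 * 2 ^ Suc n"

lemma filterlim_loop_scale: "filterlim loop_scale at_top sequentially"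
  unfolding loop_scale_def by real_asymp

lemma loop_point_dist:
  assumes \<theta>: "\<theta> \<in> {0..<1}" and \<psi>: "\<psi> \<in> {0..<1}"
  shows "(\<lambda>n. mdist X (loop_point \<theta> n) (loop_point \<psi> n) / loop_scale n) \<longlonglongrightarrow> arc_dist \<theta> \<psi>"
proof -
  define c :: "nat \<Rightarrow> real" where "c n = 2 * 2 ^ Suc n" for n
  define i where "i \<theta> n = nat \<lfloor>\<theta> * c n\<rfloor>" for \<theta> n
  have c: "filterlim c at_top sequentially" "c n > 0" for n
    unfolding c_def by (real_asymp, simp)
  have i: "i \<theta> n < 2 * 2 ^ Suc n" if "\<theta> \<in> {0..<1}" for \<theta> n
  proof -
    have "0 \<le> \<theta> * c n" "\<theta> * c n < c n" using that c(2)[of n] by simp_all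
    then have "real (i \<theta> n) < c n" unfolding i_def by linarith
    then have "real (i \<theta> n) < real (2 * 2 ^ Suc n)" by (simp add: c_def)
    then show ?thesis by (simp only: of_nat_less_iff)
  qed
  let ?d = "\<lambda>n. mdist X (loop_point \<theta> n) (loop_point \<psi> n) / loop_scale n"
  let ?r = "\<lambda>n. \<bar>real (i \<theta> n) / c n - real (i \<psi> n) / c n\<bar>"
  let ?e = "\<lambda>n. (20 + 10 * real n) / loop_scale n"
  have "(\<lambda>n. min (?r n) (1 - ?r n)) \<longlonglongrightarrow> min \<bar>\<theta> - \<psi>\<bar> (1 - \<bar>\<theta> - \<psi>\<bar>)"
    unfolding i_def using \<theta> \<psi> c(1) by (intro tendsto_intros floor_ratio_tendsto) auto
  then have r: "(\<lambda>n. min (?r n) (1 - ?r n)) \<longlonglongrightarrow> arc_dist \<theta> \<psi>"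
    using \<theta> \<psi> by (simp add: arc_dist_eq)
  have bound: "\<bar>?d n - min (?r n) (1 - ?r n)\<bar> \<le> ?e n" for n
  proof -
    let ?D = "\<bar>real (i \<theta> n) - real (i \<psi> n)\<bar>"
    have s: "loop_scale n = 5 * c n" by (simp add: loop_scale_def c_def)
    have "?r n = ?D / c n" using c(2)[of n] by (simp add: diff_divide_distrib[symmetric])
    then have "min (?r n) (1 - ?r n) = min (?D / c n) ((c n - ?D) / c n)"
      using c(2)[of n] by (simp add: diff_divide_distrib)
    also have "\<dots> = 5 * min ?D (c n - ?D) / loop_scale n"
      using c(2)[of n] by (auto simp: s min_def divide_le_cancel)
    finally have eq: "?d n - min (?r n) (1 - ?r n)
        = (mdist X (loop_point \<theta> n) (loop_point \<psi> n) - 5 * min ?D (c n - ?D)) / loop_scale n"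
      by (simp add: diff_divide_distrib)
    have "\<bar>mdist X (loop_point \<theta> n) (loop_point \<psi> n) - 5 * min ?D (c n - ?D)\<bar> \<le> 20 + 10 * real n"
      using loop_dist[OF i[OF \<theta>] i[OF \<psi>], of n] by (simp only: loop_point_def i_def c_def)
    then have "\<bar>mdist X (loop_point \<theta> n) (loop_point \<psi> n) - 5 * min ?D (c n - ?D)\<bar> / loop_scale n \<le> ?e n"
      by (rule divide_right_mono) (simp add: loop_scale_def)
    moreover have "\<bar>loop_scale n\<bar> = loop_scale n" by (simp add: loop_scale_def)
    ultimately show ?thesis unfolding eq abs_divide by (simp only:)
  qed
  have "(\<lambda>n. ?d n - min (?r n) (1 - ?r n)) \<longlonglongrightarrow> 0"
  proof (rule Lim_null_comparison)
    show "eventually (\<lambda>n. norm (?d n - min (?r n) (1 - ?r n)) \<le> ?e n) sequentially"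
      unfolding real_norm_def by (intro always_eventually allI bound)
    show "?e \<longlonglongrightarrow> 0" unfolding loop_scale_def by real_asymp
  qed
  from tendsto_add[OF this r] show ?thesis by simp
qed

lemma cone_contains_circle:
  "\<exists>C. is_asymptotic_cone X C \<and> (\<exists>f. isometric_embedding unit_length_circle C f)"
proof -
  obtain \<omega> where \<omega>: "nonprincipal_ultrafilter \<omega>" "\<omega> \<le> sequentially"
    by (rule ex_nonprincipal_ultrafilter)
  let ?b = "loop_point 0"
  define C where "C = asymptotic_cone \<omega> X ?b loop_scale"
  have s: "0 < loop_scale n" for n by (simp add: loop_scale_def)
  have lp: "loop_point \<theta> n \<in> mspace X" for \<theta> n by (simp add: loop_point_def)
  have cone: "is_asymptotic_cone X C"
    unfolding is_asymptotic_cone_def C_def using \<omega>(1) s lp filterlim_loop_scale by blast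
  have cd: "cone_dist \<omega> X loop_scale (loop_point \<theta>) (loop_point \<psi>) = ereal (arc_dist \<theta> \<psi>)"
    if "\<theta> \<in> {0..<1}" "\<psi> \<in> {0..<1}" for \<theta> \<psi>
  proof -
    have "((\<lambda>n. ereal (mdist X (loop_point \<theta> n) (loop_point \<psi> n) / loop_scale n))
        \<longlongrightarrow> ereal (arc_dist \<theta> \<psi>)) \<omega>"
      using loop_point_dist[OF that] \<omega>(2) by (auto intro: tendsto_mono)
    then show ?thesis
      using \<omega>(1) unfolding cone_dist_def
      by (intro tendsto_Lim) (simp_all add: nonprincipal_ultrafilter_def)
  qed
  have seqs: "loop_point \<theta> \<in> cone_seqs \<omega> X ?b loop_scale" if "\<theta> \<in> {0..<1}" for \<theta>
    using cd[of 0 \<theta>] that lp by (simp add: cone_seqs_def)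
  let ?f = "\<lambda>\<theta>. cone_rel \<omega> X ?b loop_scale `` {loop_point \<theta>}"
  note ms = mspace_asymptotic_cone[OF \<omega>(1) s lp] mdist_asymptotic_cone[OF \<omega>(1) s lp]
  have "isometric_embedding unit_length_circle C ?f"
    unfolding isometric_embedding_def C_def ms mspace_unit_length_circle mdist_unit_length_circle
  proof (intro conjI ballI)
    show "?f ` {0..<1} \<subseteq> cone_points \<omega> X ?b loop_scale"
      using seqs by (auto simp: cone_points_def intro: quotientI)
    fix \<theta> \<psi> :: real assume *: "\<theta> \<in> {0..<1}" "\<psi> \<in> {0..<1}"
    show "cone_quotient_dist \<omega> X ?b loop_scale (?f \<theta>) (?f \<psi>) = arc_dist \<theta> \<psi>"
      using cone_quotient_dist_class[OF \<omega>(1) s lp seqs[OF *(1)] seqs[OF *(2)]] cd[OF *] by simp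
  qed
  then show ?thesis using cone by blast
qed

end

theorem corollary4p0p3:
  fixes L :: nat
  assumes "even L" and "6 \<le> L"
  shows "\<exists>C. is_asymptotic_cone (snowflake_graph L) C \<and>
    (\<exists>f. isometric_embedding unit_length_circle C f)"
proof -
  interpret snowflake L by unfold_locales (rule assms(2))
  show ?thesis by (rule cone_contains_circle)
qed

end
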